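(* The set $D^2(A_1)=\{\alpha\in\mathcal N:\alpha^0=\underline0\ \vee\ \alpha^1=\underline0\}$ positively fails to be regular in Lusin's sense: for every spread $F\subseteq\mathcal N$ and every $\gamma$ coding a continuous function from $F$ to $\mathcal N$ that maps $F$ onto $D^2(A_1)$, there exist $\alpha,\beta\in F$ such that $\alpha\#\beta$ and $\gamma|\alpha=\gamma|\beta$.
   Context: Framework: Brouwer's intuitionistic analysis (intuitionistic logic, countable choice, Brouwer's Continuity Principle (also for spreads), axioms of continuous choice, Thesis on Bars, Fan Theorem). $\mathcal N=\mathbb N^{\mathbb N}$; finite sequences coded by numbers, $\overline\alpha n=\langle\alpha(0),\dots,\alpha(n-1)\rangle$, $\alpha^m(k)=\alpha(\langle m\rangle*k)$, $\underline0$ the zero sequence. $\alpha\#\beta$ iff $\exists n\,\alpha(n)\ne\beta(n)$. A spread is a set $F=\{\alpha:\forall n\,\beta(\overline\alpha n)=0\}$ where $\beta$ satisfies $\forall s[\beta(s)=0\leftrightarrow\exists n\,\beta(s*\langle n\rangle)=0]$. $\gamma$ codes a continuous function from $F$ to $\mathcal N$ iff for each $n$, $\forall\alpha\in F\,\exists m\,\gamma^n(\overline\alpha m)\ne0$; then $(\gamma|\alpha)(n)=p$ where the first nonzero value $\gamma^n(\overline\alpha m)$ is $p+1$. Onto $D^2(A_1)$ means $\{\gamma|\alpha:\alpha\in F\}=D^2(A_1)$. *)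

theory Defs
  imports Main
begin

text \<open>
  HOL is classical, and read directly in HOL the statement at hand is false: classically the set
  \<open>D\<^sup>2(A\<^sub>1)\<close> is closed, hence itself a spread, and the identity is a continuous injection of it onto
  itself. Brouwer's intuitionistic analysis is therefore represented as a formal theory (two-sorted
  intuitionistic predicate logic plus Brouwer's axioms), and its theorems as derivable formulas.

  There are two sorts, natural numbers and infinite sequences of natural numbers. Variables are de
  Bruijn indices, counted separately for the two sorts: \<open>NVar i\<close> skips the \<open>i\<close> innermost
  \<^emph>\<open>number\<close> binders, \<open>SVar i\<close> the \<open>i\<close> innermost \<^emph>\<open>sequence\<close> binders.
\<close>

text \<open>
  Every natural number codes a finite sequence: \<open>Zero\<close> codes the empty one, \<open>Cns m s\<close> codes
  \<open>\<langle>m\<rangle>*s\<close>, and \<open>Append s t\<close> codes \<open>s*t\<close>. The coding is only fixed by its axioms (in \<open>ax\<close> below).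
  \<open>Rec a b n\<close> is the value at \<open>n\<close> of the function defined by primitive recursion with initial
  value \<open>a\<close> and step \<open>b\<close>; in \<open>b\<close>, \<open>NVar 0\<close> is the previous value and \<open>NVar 1\<close> its index.
  \<open>Lam t\<close> is the sequence \<open>\<lambda>n. t\<close> (binding \<open>NVar 0\<close>), \<open>Ap a n\<close> is \<open>a(n)\<close>.
\<close>

datatype ntm =
    NVar nat
  | Zero
  | Succ ntm
  | Cns ntm ntm
  | Hd ntm
  | Tl ntm
  | Append ntm ntm
  | Rec ntm ntm ntm
  | Ap stm ntm
and stm =
    SVar nat
  | Lam ntm

datatype fm =
    Eq ntm ntm  (infix \<open>\<^bold>=\<close> 50)
  | Fls
  | And fm fm  (infixr \<open>\<^bold>\<and>\<close> 35)
  | Or fm fm  (infixr \<open>\<^bold>\<or>\<close> 30)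
  | Imp fm fm  (infixr \<open>\<^bold>\<longrightarrow>\<close> 25)
  | AllN fm
  | ExN fm
  | AllS fm
  | ExS fm

definition Neg :: "fm \<Rightarrow> fm"  (\<open>\<^bold>\<not> _\<close> [40] 40)
  where "(\<^bold>\<not> \<phi>) = (\<phi> \<^bold>\<longrightarrow> Fls)"

definition Iff :: "fm \<Rightarrow> fm \<Rightarrow> fm"  (infixr \<open>\<^bold>\<longleftrightarrow>\<close> 25)
  where "(\<phi> \<^bold>\<longleftrightarrow> \<psi>) = ((\<phi> \<^bold>\<longrightarrow> \<psi>) \<^bold>\<and> (\<psi> \<^bold>\<longrightarrow> \<phi>))"


section \<open>Renaming and substitution\<close>

text \<open>In all functions below the first argument acts on number variables, the second on sequence
  variables.\<close>

abbreviation up :: "(nat \<Rightarrow> nat) \<Rightarrow> nat \<Rightarrow> nat"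
  where "up r \<equiv> case_nat 0 (\<lambda>i. Suc (r i))"

primrec ren_n :: "(nat \<Rightarrow> nat) \<Rightarrow> (nat \<Rightarrow> nat) \<Rightarrow> ntm \<Rightarrow> ntm"
  and ren_s :: "(nat \<Rightarrow> nat) \<Rightarrow> (nat \<Rightarrow> nat) \<Rightarrow> stm \<Rightarrow> stm"
where
  "ren_n r q (NVar i) = NVar (r i)"
| "ren_n r q Zero = Zero"
| "ren_n r q (Succ t) = Succ (ren_n r q t)"
| "ren_n r q (Cns t u) = Cns (ren_n r q t) (ren_n r q u)"
| "ren_n r q (Hd t) = Hd (ren_n r q t)"
| "ren_n r q (Tl t) = Tl (ren_n r q t)"
| "ren_n r q (Append t u) = Append (ren_n r q t) (ren_n r q u)"
| "ren_n r q (Rec a b n) = Rec (ren_n r q a) (ren_n (up (up r)) q b) (ren_n r q n)"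
| "ren_n r q (Ap a t) = Ap (ren_s r q a) (ren_n r q t)"
| "ren_s r q (SVar i) = SVar (q i)"
| "ren_s r q (Lam t) = Lam (ren_n (up r) q t)"

primrec ren :: "(nat \<Rightarrow> nat) \<Rightarrow> (nat \<Rightarrow> nat) \<Rightarrow> fm \<Rightarrow> fm"
where
  "ren r q (t \<^bold>= u) = (ren_n r q t \<^bold>= ren_n r q u)"
| "ren r q Fls = Fls"
| "ren r q (\<phi> \<^bold>\<and> \<psi>) = (ren r q \<phi> \<^bold>\<and> ren r q \<psi>)"
| "ren r q (\<phi> \<^bold>\<or> \<psi>) = (ren r q \<phi> \<^bold>\<or> ren r q \<psi>)"
| "ren r q (\<phi> \<^bold>\<longrightarrow> \<psi>) = (ren r q \<phi> \<^bold>\<longrightarrow> ren r q \<psi>)"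
| "ren r q (AllN \<phi>) = AllN (ren (up r) q \<phi>)"
| "ren r q (ExN \<phi>) = ExN (ren (up r) q \<phi>)"
| "ren r q (AllS \<phi>) = AllS (ren r (up q) \<phi>)"
| "ren r q (ExS \<phi>) = ExS (ren r (up q) \<phi>)"

text \<open>Weakening by one number variable (\<open>N\<close>) or one sequence variable (\<open>S\<close>).\<close>

abbreviation wkN_n :: "ntm \<Rightarrow> ntm" where "wkN_n \<equiv> ren_n Suc id"
abbreviation wkN_s :: "stm \<Rightarrow> stm" where "wkN_s \<equiv> ren_s Suc id"
abbreviation wkN :: "fm \<Rightarrow> fm" where "wkN \<equiv> ren Suc id"
abbreviation wkS_n :: "ntm \<Rightarrow> ntm" where "wkS_n \<equiv> ren_n id Suc"
abbreviation wkS_s :: "stm \<Rightarrow> stm" where "wkS_s \<equiv> ren_s id Suc"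
abbreviation wkS :: "fm \<Rightarrow> fm" where "wkS \<equiv> ren id Suc"

abbreviation upN :: "(nat \<Rightarrow> ntm) \<Rightarrow> nat \<Rightarrow> ntm"
  where "upN \<sigma> \<equiv> case_nat (NVar 0) (\<lambda>i. wkN_n (\<sigma> i))"

abbreviation upS :: "(nat \<Rightarrow> stm) \<Rightarrow> nat \<Rightarrow> stm"
  where "upS \<tau> \<equiv> case_nat (SVar 0) (\<lambda>i. wkS_s (\<tau> i))"

primrec sub_n :: "(nat \<Rightarrow> ntm) \<Rightarrow> (nat \<Rightarrow> stm) \<Rightarrow> ntm \<Rightarrow> ntm"
  and sub_s :: "(nat \<Rightarrow> ntm) \<Rightarrow> (nat \<Rightarrow> stm) \<Rightarrow> stm \<Rightarrow> stm"
where
  "sub_n \<sigma> \<tau> (NVar i) = \<sigma> i"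
| "sub_n \<sigma> \<tau> Zero = Zero"
| "sub_n \<sigma> \<tau> (Succ t) = Succ (sub_n \<sigma> \<tau> t)"
| "sub_n \<sigma> \<tau> (Cns t u) = Cns (sub_n \<sigma> \<tau> t) (sub_n \<sigma> \<tau> u)"
| "sub_n \<sigma> \<tau> (Hd t) = Hd (sub_n \<sigma> \<tau> t)"
| "sub_n \<sigma> \<tau> (Tl t) = Tl (sub_n \<sigma> \<tau> t)"
| "sub_n \<sigma> \<tau> (Append t u) = Append (sub_n \<sigma> \<tau> t) (sub_n \<sigma> \<tau> u)"
| "sub_n \<sigma> \<tau> (Rec a b n) =
     Rec (sub_n \<sigma> \<tau> a) (sub_n (upN (upN \<sigma>)) (\<lambda>i. wkN_s (wkN_s (\<tau> i))) b) (sub_n \<sigma> \<tau> n)"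
| "sub_n \<sigma> \<tau> (Ap a t) = Ap (sub_s \<sigma> \<tau> a) (sub_n \<sigma> \<tau> t)"
| "sub_s \<sigma> \<tau> (SVar i) = \<tau> i"
| "sub_s \<sigma> \<tau> (Lam t) = Lam (sub_n (upN \<sigma>) (\<lambda>i. wkN_s (\<tau> i)) t)"

primrec sub :: "(nat \<Rightarrow> ntm) \<Rightarrow> (nat \<Rightarrow> stm) \<Rightarrow> fm \<Rightarrow> fm"
where
  "sub \<sigma> \<tau> (t \<^bold>= u) = (sub_n \<sigma> \<tau> t \<^bold>= sub_n \<sigma> \<tau> u)"
| "sub \<sigma> \<tau> Fls = Fls"
| "sub \<sigma> \<tau> (\<phi> \<^bold>\<and> \<psi>) = (sub \<sigma> \<tau> \<phi> \<^bold>\<and> sub \<sigma> \<tau> \<psi>)"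
| "sub \<sigma> \<tau> (\<phi> \<^bold>\<or> \<psi>) = (sub \<sigma> \<tau> \<phi> \<^bold>\<or> sub \<sigma> \<tau> \<psi>)"
| "sub \<sigma> \<tau> (\<phi> \<^bold>\<longrightarrow> \<psi>) = (sub \<sigma> \<tau> \<phi> \<^bold>\<longrightarrow> sub \<sigma> \<tau> \<psi>)"
| "sub \<sigma> \<tau> (AllN \<phi>) = AllN (sub (upN \<sigma>) (\<lambda>i. wkN_s (\<tau> i)) \<phi>)"
| "sub \<sigma> \<tau> (ExN \<phi>) = ExN (sub (upN \<sigma>) (\<lambda>i. wkN_s (\<tau> i)) \<phi>)"
| "sub \<sigma> \<tau> (AllS \<phi>) = AllS (sub (\<lambda>i. wkS_n (\<sigma> i)) (upS \<tau>) \<phi>)"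
| "sub \<sigma> \<tau> (ExS \<phi>) = ExS (sub (\<lambda>i. wkS_n (\<sigma> i)) (upS \<tau>) \<phi>)"

abbreviation instN :: "ntm \<Rightarrow> fm \<Rightarrow> fm"
  where "instN t \<equiv> sub (case_nat t NVar) SVar"

abbreviation instS :: "stm \<Rightarrow> fm \<Rightarrow> fm"
  where "instS a \<equiv> sub NVar (case_nat a SVar)"


section \<open>Notions of intuitionistic analysis\<close>

definition Plus :: "ntm \<Rightarrow> ntm \<Rightarrow> ntm"
  where "Plus t u = Rec t (Succ (NVar 0)) u"

definition Less :: "ntm \<Rightarrow> ntm \<Rightarrow> fm"
  where "Less t u = ExN (Plus (wkN_n t) (Succ (NVar 0)) \<^bold>= wkN_n u)"

text \<open>\<open>snoc s n\<close> is \<open>s*\<langle>n\<rangle>\<close>; \<open>bar a n\<close> is the code of the initial segment of \<open>a\<close> of length \<open>n\<close>;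
  \<open>sect a m\<close> is the sequence \<open>a\<^sup>m = \<lambda>k. a(\<langle>m\<rangle>*k)\<close>.\<close>

definition snoc :: "ntm \<Rightarrow> ntm \<Rightarrow> ntm"
  where "snoc s n = Append s (Cns n Zero)"

definition bar :: "stm \<Rightarrow> ntm \<Rightarrow> ntm"
  where "bar a n = Rec Zero (snoc (NVar 0) (Ap (wkN_s (wkN_s a)) (NVar 1))) n"

definition sect :: "stm \<Rightarrow> ntm \<Rightarrow> stm"
  where "sect a m = Lam (Ap (wkN_s a) (Cns (wkN_n m) (NVar 0)))"

definition zero_seq :: stm
  where "zero_seq = Lam Zero"

definition seq_eq :: "stm \<Rightarrow> stm \<Rightarrow> fm"
  where "seq_eq a b = AllN (Ap (wkN_s a) (NVar 0) \<^bold>= Ap (wkN_s b) (NVar 0))"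

definition apart :: "stm \<Rightarrow> stm \<Rightarrow> fm"
  where "apart a b = ExN (\<^bold>\<not> (Ap (wkN_s a) (NVar 0) \<^bold>= Ap (wkN_s b) (NVar 0)))"

definition spread_law :: "stm \<Rightarrow> fm"
  where "spread_law b =
    AllN ((Ap (wkN_s b) (NVar 0) \<^bold>= Zero) \<^bold>\<longleftrightarrow>
      ExN (Ap (wkN_s (wkN_s b)) (snoc (NVar 1) (NVar 0)) \<^bold>= Zero))"

text \<open>\<open>in_spread b a\<close>: \<open>a\<close> belongs to the spread given by the law \<open>b\<close>.\<close>

definition in_spread :: "stm \<Rightarrow> stm \<Rightarrow> fm"
  where "in_spread b a = AllN (Ap (wkN_s b) (bar (wkN_s a) (NVar 0)) \<^bold>= Zero)"

text \<open>A spread is a fan if every admitted finite sequence has boundedly many admitted immediate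
  extensions.\<close>

definition fan_law :: "stm \<Rightarrow> fm"
  where "fan_law b = (spread_law b \<^bold>\<and>
    AllN ((Ap (wkN_s b) (NVar 0) \<^bold>= Zero) \<^bold>\<longrightarrow>
      ExN (AllN ((Ap (wkN_s (wkN_s (wkN_s b))) (snoc (NVar 2) (NVar 0)) \<^bold>= Zero) \<^bold>\<longrightarrow>
        Less (NVar 0) (NVar 1)))))"

text \<open>\<open>num_value g a p\<close>: the first nonzero value \<open>g(bar a m)\<close>, \<open>m = 0, 1, \<dots>\<close>, exists and equals \<open>p + 1\<close>.
  \<open>fun_value g a c\<close>: \<open>g|a = c\<close>.\<close>

definition num_value :: "stm \<Rightarrow> stm \<Rightarrow> ntm \<Rightarrow> fm"
  where "num_value g a p =
    ExN ((Ap (wkN_s g) (bar (wkN_s a) (NVar 0)) \<^bold>= Succ (wkN_n p)) \<^bold>\<and>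
      AllN (Less (NVar 0) (NVar 1) \<^bold>\<longrightarrow>
        Ap (wkN_s (wkN_s g)) (bar (wkN_s (wkN_s a)) (NVar 0)) \<^bold>= Zero))"

definition fun_value :: "stm \<Rightarrow> stm \<Rightarrow> stm \<Rightarrow> fm"
  where "fun_value g a c =
    AllN (num_value (sect (wkN_s g) (NVar 0)) (wkN_s a) (Ap (wkN_s c) (NVar 0)))"

text \<open>\<open>codes_fun g b\<close>: \<open>g\<close> codes a continuous function from the spread \<open>b\<close> to Baire space. The
  universal spread has the law \<open>zero_seq\<close>.\<close>

definition codes_fun :: "stm \<Rightarrow> stm \<Rightarrow> fm"
  where "codes_fun g b =
    AllN (AllS (in_spread (wkS_s (wkN_s b)) (SVar 0) \<^bold>\<longrightarrow>
      ExN (\<^bold>\<not> (Ap (sect (wkN_s (wkS_s (wkN_s g))) (NVar 1)) (bar (SVar 0) (NVar 0)) \<^bold>= Zero))))"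

definition in_D2A1 :: "stm \<Rightarrow> fm"
  where "in_D2A1 a =
    (seq_eq (sect a Zero) zero_seq \<^bold>\<or> seq_eq (sect a (Succ Zero)) zero_seq)"

text \<open>\<open>{g|a : a \<in> F\<^sub>b} = D\<^sup>2(A\<^sub>1)\<close>, where \<open>F\<^sub>b\<close> is the spread with law \<open>b\<close>.\<close>

definition onto_D2A1 :: "stm \<Rightarrow> stm \<Rightarrow> fm"
  where "onto_D2A1 g b =
    AllS (ExS (in_spread (wkS_s (wkS_s b)) (SVar 0) \<^bold>\<and>
        fun_value (wkS_s (wkS_s g)) (SVar 0) (SVar 1))
      \<^bold>\<longleftrightarrow> in_D2A1 (SVar 0))"


section \<open>The formal theory\<close>

text \<open>In the schemes, \<open>\<phi>\<close> and \<open>\<psi>\<close> are arbitrary formulas, possibly with further free variables of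
  both sorts.\<close>

inductive_set ax :: "fm set"
where
  Refl: "(t \<^bold>= t) \<in> ax"
| Leibniz: "((t \<^bold>= u) \<^bold>\<longrightarrow> instN t \<phi> \<^bold>\<longrightarrow> instN u \<phi>) \<in> ax"
| Succ_nonzero: "(\<^bold>\<not> (Succ t \<^bold>= Zero)) \<in> ax"
| Succ_inject: "((Succ t \<^bold>= Succ u) \<^bold>\<longrightarrow> t \<^bold>= u) \<in> ax"
| Induction: "(instN Zero \<phi> \<^bold>\<and>
    AllN (\<phi> \<^bold>\<longrightarrow> sub (case_nat (Succ (NVar 0)) (\<lambda>i. NVar (Suc i))) SVar \<phi>) \<^bold>\<longrightarrow> AllN \<phi>) \<in> ax"
| Rec_Zero: "(Rec t b Zero \<^bold>= t) \<in> ax"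
| Rec_Succ: "(Rec t b (Succ u) \<^bold>=
    sub_n (case_nat (Rec t b u) (case_nat u NVar)) SVar b) \<in> ax"
| Beta: "(Ap (Lam t) u \<^bold>= sub_n (case_nat u NVar) SVar t) \<in> ax"
| Cns_nonzero: "(\<^bold>\<not> (Cns t u \<^bold>= Zero)) \<in> ax"
| Hd_Cns: "(Hd (Cns t u) \<^bold>= t) \<in> ax"
| Tl_Cns: "(Tl (Cns t u) \<^bold>= u) \<in> ax"
| Cns_exhaust: "((t \<^bold>= Zero) \<^bold>\<or> (t \<^bold>= Cns (Hd t) (Tl t))) \<in> ax"
| Cns_greater_hd: "Less t (Cns t u) \<in> ax"
| Cns_greater_tl: "Less u (Cns t u) \<in> ax"
| Append_Zero: "(Append Zero u \<^bold>= u) \<in> ax"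
| Append_Cns: "(Append (Cns t s) u \<^bold>= Cns t (Append s u)) \<in> ax"
  \<comment> \<open>Countable choice. \<open>AC00\<close>: \<open>\<phi>(m,n)\<close> with \<open>m = NVar 1\<close>, \<open>n = NVar 0\<close>;
    from \<open>\<forall>m \<exists>n \<phi>(m,n)\<close> infer \<open>\<exists>\<alpha> \<forall>m \<phi>(m,\<alpha>(m))\<close>.
    \<open>AC01\<close>: \<open>\<phi>(m,\<alpha>)\<close> with \<open>m = NVar 0\<close>, \<open>\<alpha> = SVar 0\<close>;
    from \<open>\<forall>m \<exists>\<alpha> \<phi>(m,\<alpha>)\<close> infer \<open>\<exists>\<alpha> \<forall>m \<phi>(m,\<alpha>\<^sup>m)\<close>.\<close>
| AC00: "(AllN (ExN \<phi>) \<^bold>\<longrightarrow>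
    ExS (AllN (sub (case_nat (Ap (SVar 0) (NVar 0)) NVar) (\<lambda>i. SVar (Suc i)) \<phi>))) \<in> ax"
| AC01: "(AllN (ExS \<phi>) \<^bold>\<longrightarrow>
    ExS (AllN (sub NVar (case_nat (sect (SVar 0) (NVar 0)) (\<lambda>i. SVar (Suc i))) \<phi>))) \<in> ax"
  \<comment> \<open>Brouwer's Continuity Principle for a spread \<open>F\<close> with law \<open>b\<close> (\<open>b = zero_seq\<close>: Baire space);
    \<open>\<phi>(\<alpha>,n)\<close> with \<open>\<alpha> = SVar 0\<close>, \<open>n = NVar 0\<close>. From \<open>\<forall>\<alpha>\<in>F \<exists>n \<phi>(\<alpha>,n)\<close> infer
    \<open>\<forall>\<alpha>\<in>F \<exists>m \<exists>n \<forall>\<beta>\<in>F (bar \<beta> m = bar \<alpha> m \<longrightarrow> \<phi>(\<beta>,n))\<close>.\<close>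
| BCP: "(spread_law b \<^bold>\<longrightarrow>
    AllS (in_spread (wkS_s b) (SVar 0) \<^bold>\<longrightarrow> ExN \<phi>) \<^bold>\<longrightarrow>
    AllS (in_spread (wkS_s b) (SVar 0) \<^bold>\<longrightarrow>
      ExN (ExN (AllS (in_spread (wkS_s (wkS_s (wkN_s (wkN_s b)))) (SVar 0) \<^bold>\<longrightarrow>
        (bar (SVar 0) (NVar 1) \<^bold>= bar (SVar 1) (NVar 1)) \<^bold>\<longrightarrow>
        ren (up Suc) (up Suc) \<phi>))))) \<in> ax"
  \<comment> \<open>Continuous choice. \<open>AC10\<close>: \<open>\<phi>(\<alpha>,n)\<close> with \<open>\<alpha> = SVar 0\<close>, \<open>n = NVar 0\<close>.
    \<open>AC11\<close>: \<open>\<phi>(\<alpha>,\<beta>)\<close> with \<open>\<alpha> = SVar 1\<close>, \<open>\<beta> = SVar 0\<close>.\<close>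
| AC10: "(AllS (ExN \<phi>) \<^bold>\<longrightarrow>
    ExS (AllS (ExN (\<^bold>\<not> (Ap (SVar 1) (bar (SVar 0) (NVar 0)) \<^bold>= Zero))) \<^bold>\<and>
      AllS (ExN (num_value (SVar 1) (SVar 0) (NVar 0) \<^bold>\<and>
        ren id (up Suc) \<phi>)))) \<in> ax"
| AC11: "(AllS (ExS \<phi>) \<^bold>\<longrightarrow>
    ExS (codes_fun (SVar 0) zero_seq \<^bold>\<and>
      AllS (ExS (fun_value (SVar 2) (SVar 1) (SVar 0) \<^bold>\<and>
        ren id (up (up Suc)) \<phi>)))) \<in> ax"
  \<comment> \<open>Thesis on Bars, as the principle of bar induction: if \<open>B\<close> (given by \<open>\<phi>\<close>) is a bar in Baire
    space, \<open>B \<subseteq> C\<close> (given by \<open>\<psi>\<close>), and \<open>C\<close> is monotone and inductive, then \<open>\<langle>\<rangle> \<in> C\<close>.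
    The finite sequence is \<open>NVar 0\<close> in \<open>\<phi>\<close> and \<open>\<psi>\<close>.\<close>
| Thesis_on_Bars: "(AllS (ExN (sub (case_nat (bar (SVar 0) (NVar 0)) (\<lambda>i. NVar (Suc i)))
        (\<lambda>i. SVar (Suc i)) \<phi>)) \<^bold>\<longrightarrow>
    AllN (\<phi> \<^bold>\<longrightarrow> \<psi>) \<^bold>\<longrightarrow>
    AllN (\<psi> \<^bold>\<longleftrightarrow>
      AllN (sub (case_nat (snoc (NVar 1) (NVar 0)) (\<lambda>i. NVar (Suc (Suc i)))) SVar \<psi>)) \<^bold>\<longrightarrow>
    instN Zero \<psi>) \<in> ax"
  \<comment> \<open>Fan Theorem for a fan \<open>F\<close> with law \<open>b\<close>: if \<open>\<forall>\<alpha>\<in>F \<exists>n \<phi>(bar \<alpha> n)\<close>, then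
    \<open>\<exists>m \<forall>\<alpha>\<in>F \<exists>n<m \<phi>(bar \<alpha> n)\<close>. The finite sequence is \<open>NVar 0\<close> in \<open>\<phi>\<close>.\<close>
| Fan: "(fan_law b \<^bold>\<longrightarrow>
    AllS (in_spread (wkS_s b) (SVar 0) \<^bold>\<longrightarrow>
      ExN (sub (case_nat (bar (SVar 0) (NVar 0)) (\<lambda>i. NVar (Suc i)))
        (\<lambda>i. SVar (Suc i)) \<phi>)) \<^bold>\<longrightarrow>
    ExN (AllS (in_spread (wkS_s (wkN_s b)) (SVar 0) \<^bold>\<longrightarrow>
      ExN (Less (NVar 0) (NVar 1) \<^bold>\<and>
        sub (case_nat (bar (SVar 0) (NVar 0)) (\<lambda>i. NVar (Suc (Suc i))))
          (\<lambda>i. SVar (Suc i)) \<phi>)))) \<in> ax"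

text \<open>Natural deduction for two-sorted intuitionistic predicate logic over the axioms \<open>ax\<close>.\<close>

inductive derivable :: "fm set \<Rightarrow> fm \<Rightarrow> bool"  (infix \<open>\<turnstile>\<close> 20)
where
  Ax: "\<phi> \<in> ax \<Longrightarrow> \<Gamma> \<turnstile> \<phi>"
| Assm: "\<phi> \<in> \<Gamma> \<Longrightarrow> \<Gamma> \<turnstile> \<phi>"
| FlsE: "\<Gamma> \<turnstile> Fls \<Longrightarrow> \<Gamma> \<turnstile> \<phi>"
| AndI: "\<Gamma> \<turnstile> \<phi> \<Longrightarrow> \<Gamma> \<turnstile> \<psi> \<Longrightarrow> \<Gamma> \<turnstile> \<phi> \<^bold>\<and> \<psi>"
| AndE1: "\<Gamma> \<turnstile> \<phi> \<^bold>\<and> \<psi> \<Longrightarrow> \<Gamma> \<turnstile> \<phi>"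
| AndE2: "\<Gamma> \<turnstile> \<phi> \<^bold>\<and> \<psi> \<Longrightarrow> \<Gamma> \<turnstile> \<psi>"
| OrI1: "\<Gamma> \<turnstile> \<phi> \<Longrightarrow> \<Gamma> \<turnstile> \<phi> \<^bold>\<or> \<psi>"
| OrI2: "\<Gamma> \<turnstile> \<psi> \<Longrightarrow> \<Gamma> \<turnstile> \<phi> \<^bold>\<or> \<psi>"
| OrE: "\<Gamma> \<turnstile> \<phi> \<^bold>\<or> \<psi> \<Longrightarrow> insert \<phi> \<Gamma> \<turnstile> \<chi> \<Longrightarrow> insert \<psi> \<Gamma> \<turnstile> \<chi> \<Longrightarrow> \<Gamma> \<turnstile> \<chi>"
| ImpI: "insert \<phi> \<Gamma> \<turnstile> \<psi> \<Longrightarrow> \<Gamma> \<turnstile> \<phi> \<^bold>\<longrightarrow> \<psi>"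
| ImpE: "\<Gamma> \<turnstile> \<phi> \<^bold>\<longrightarrow> \<psi> \<Longrightarrow> \<Gamma> \<turnstile> \<phi> \<Longrightarrow> \<Gamma> \<turnstile> \<psi>"
| AllNI: "wkN ` \<Gamma> \<turnstile> \<phi> \<Longrightarrow> \<Gamma> \<turnstile> AllN \<phi>"
| AllNE: "\<Gamma> \<turnstile> AllN \<phi> \<Longrightarrow> \<Gamma> \<turnstile> instN t \<phi>"
| ExNI: "\<Gamma> \<turnstile> instN t \<phi> \<Longrightarrow> \<Gamma> \<turnstile> ExN \<phi>"
| ExNE: "\<Gamma> \<turnstile> ExN \<phi> \<Longrightarrow> insert \<phi> (wkN ` \<Gamma>) \<turnstile> wkN \<chi> \<Longrightarrow> \<Gamma> \<turnstile> \<chi>"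
| AllSI: "wkS ` \<Gamma> \<turnstile> \<phi> \<Longrightarrow> \<Gamma> \<turnstile> AllS \<phi>"
| AllSE: "\<Gamma> \<turnstile> AllS \<phi> \<Longrightarrow> \<Gamma> \<turnstile> instS a \<phi>"
| ExSI: "\<Gamma> \<turnstile> instS a \<phi> \<Longrightarrow> \<Gamma> \<turnstile> ExS \<phi>"
| ExSE: "\<Gamma> \<turnstile> ExS \<phi> \<Longrightarrow> insert \<phi> (wkS ` \<Gamma>) \<turnstile> wkS \<chi> \<Longrightarrow> \<Gamma> \<turnstile> \<chi>"

end

theory Submission
  imports Defs
begin

text \<open>
  Let \<open>g\<close> map the spread \<open>F\<close> onto \<open>D\<^sup>2(A\<^sub>1)\<close>, and let \<open>a \<in> F\<close> with \<open>g|a = 0\<close>. Every value of \<open>g\<close> has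
  its section 0 or its section 1 equal to zero, so the Continuity Principle on \<open>F\<close> gives one
  \<open>i \<in> {0, 1}\<close> and an \<open>m\<close> such that \<open>(g|c)\<^sup>i = 0\<close> for every \<open>c \<in> F\<close> agreeing with \<open>a\<close> up to \<open>m\<close>.
  On the other hand every \<open>d\<close> gives an element of \<open>D\<^sup>2(A\<^sub>1)\<close> with section \<open>i\<close> equal to \<open>d\<close> and
  section \<open>1 - i\<close> equal to zero, which has a preimage in \<open>F\<close>. By the Continuity Principle on Baire space, the initial
  segment of length \<open>m\<close> of the preimage can be chosen to be one and the same \<open>s\<close> for all \<open>d\<close> near zero.
  Some of these \<open>d\<close> are nonzero, so \<open>s\<close> is not the initial segment of \<open>a\<close>. The preimage of zero with
  initial segment \<open>s\<close> is therefore apart from \<open>a\<close>, and both are mapped to zero.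
\<close>

text \<open>Lets the simplifier rewrite the branches of \<open>up\<close> and \<open>upN\<close>.\<close>

declare nat.case_cong_weak [cong del]

section \<open>Composition laws for renamings and substitutions\<close>

lemma up_up: "up r (up r' i) = up (\<lambda>i. r (r' i)) i"
  by (simp split: nat.split)

lemma up_id: "case_nat 0 Suc = (\<lambda>i. i)"
  by (auto split: nat.split)

lemma ren_ren_tm:
  "ren_n r q (ren_n r' q' t) = ren_n (\<lambda>i. r (r' i)) (\<lambda>i. q (q' i)) t"
  "ren_s r q (ren_s r' q' a) = ren_s (\<lambda>i. r (r' i)) (\<lambda>i. q (q' i)) a"
  by (induction t and a arbitrary: r q r' q' and r q r' q') (simp_all add: up_up)

lemma ren_id_tm:
  "ren_n (\<lambda>i. i) (\<lambda>i. i) t = t"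
  "ren_s (\<lambda>i. i) (\<lambda>i. i) a = a"
  by (induction t and a) (simp_all add: up_id)

lemma upN_up: "upN \<sigma> (up r i) = upN (\<lambda>i. \<sigma> (r i)) i"
  by (simp split: nat.split)

lemma sub_ren_tm:
  "sub_n \<sigma> \<tau> (ren_n r q t) = sub_n (\<lambda>i. \<sigma> (r i)) (\<lambda>i. \<tau> (q i)) t"
  "sub_s \<sigma> \<tau> (ren_s r q a) = sub_s (\<lambda>i. \<sigma> (r i)) (\<lambda>i. \<tau> (q i)) a"
  by (induction t and a arbitrary: \<sigma> \<tau> r q and \<sigma> \<tau> r q) (simp_all add: upN_up)

lemma ren_upN: "ren_n (up r) q (upN \<sigma> i) = upN (\<lambda>i. ren_n r q (\<sigma> i)) i"
  by (simp split: nat.split add: ren_ren_tm)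

lemma ren_wkN: "ren_s (up r) q (wkN_s a) = wkN_s (ren_s r q a)"
  by (simp add: ren_ren_tm)

lemma ren_sub_tm:
  "ren_n r q (sub_n \<sigma> \<tau> t) = sub_n (\<lambda>i. ren_n r q (\<sigma> i)) (\<lambda>i. ren_s r q (\<tau> i)) t"
  "ren_s r q (sub_s \<sigma> \<tau> a) = sub_s (\<lambda>i. ren_n r q (\<sigma> i)) (\<lambda>i. ren_s r q (\<tau> i)) a"
  by (induction t and a arbitrary: \<sigma> \<tau> r q and \<sigma> \<tau> r q) (simp_all add: ren_upN ren_wkN)

lemma case_nat_NVar: "case_nat (NVar 0) (\<lambda>i. NVar (f i)) = (\<lambda>i. NVar (case_nat 0 f i))"
  by (auto split: nat.split)

lemma sub_var_tm:
  "sub_n (\<lambda>i. NVar (r i)) (\<lambda>i. SVar (q i)) t = ren_n r q t"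
  "sub_s (\<lambda>i. NVar (r i)) (\<lambda>i. SVar (q i)) a = ren_s r q a"
  by (induction t and a arbitrary: r q and r q) (simp_all add: case_nat_NVar)

text \<open>Weakenings are written with \<open>id\<close>, whereas the laws above use explicit
  functions. Numeral indices become successors, so that \<open>case_nat\<close> computes on
  them.\<close>

declare id_def [simp] numeral_2_eq_2 [simp] numeral_3_eq_3 [simp]

text \<open>With these rules the simplifier cancels an instantiation against an earlier weakening:
  the two fuse into a substitution that sends every variable to itself, which is the identity
  renaming.\<close>

lemmas subst_simps [simp] = ren_ren_tm ren_id_tm sub_ren_tm ren_sub_tm sub_var_tm

section \<open>Renaming and substitution in the defined notions\<close>

lemma ren_Plus [simp]: "ren_n r q (Plus t u) = Plus (ren_n r q t) (ren_n r q u)"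
  and sub_Plus [simp]: "sub_n \<sigma> \<tau> (Plus t u) = Plus (sub_n \<sigma> \<tau> t) (sub_n \<sigma> \<tau> u)"
  by (simp_all add: Plus_def)

lemma ren_snoc [simp]: "ren_n r q (snoc t u) = snoc (ren_n r q t) (ren_n r q u)"
  and sub_snoc [simp]: "sub_n \<sigma> \<tau> (snoc t u) = snoc (sub_n \<sigma> \<tau> t) (sub_n \<sigma> \<tau> u)"
  by (simp_all add: snoc_def)

lemma ren_bar [simp]: "ren_n r q (bar a u) = bar (ren_s r q a) (ren_n r q u)"
  and sub_bar [simp]: "sub_n \<sigma> \<tau> (bar a u) = bar (sub_s \<sigma> \<tau> a) (sub_n \<sigma> \<tau> u)"
  by (simp_all add: bar_def)

lemma ren_sect [simp]: "ren_s r q (sect a u) = sect (ren_s r q a) (ren_n r q u)"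
  and sub_sect [simp]: "sub_s \<sigma> \<tau> (sect a u) = sect (sub_s \<sigma> \<tau> a) (sub_n \<sigma> \<tau> u)"
  by (simp_all add: sect_def)

lemma ren_zero_seq [simp]: "ren_s r q zero_seq = zero_seq"
  and sub_zero_seq [simp]: "sub_s \<sigma> \<tau> zero_seq = zero_seq"
  by (simp_all add: zero_seq_def)

lemma ren_Less [simp]: "ren r q (Less t u) = Less (ren_n r q t) (ren_n r q u)"
  and sub_Less [simp]: "sub \<sigma> \<tau> (Less t u) = Less (sub_n \<sigma> \<tau> t) (sub_n \<sigma> \<tau> u)"
  by (simp_all add: Less_def)

lemma ren_Neg [simp]: "ren r q (\<^bold>\<not> \<phi>) = (\<^bold>\<not> ren r q \<phi>)"
  and sub_Neg [simp]: "sub \<sigma> \<tau> (\<^bold>\<not> \<phi>) = (\<^bold>\<not> sub \<sigma> \<tau> \<phi>)"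
  by (simp_all add: Neg_def)

lemma ren_Iff [simp]: "ren r q (\<phi> \<^bold>\<longleftrightarrow> \<psi>) = (ren r q \<phi> \<^bold>\<longleftrightarrow> ren r q \<psi>)"
  and sub_Iff [simp]: "sub \<sigma> \<tau> (\<phi> \<^bold>\<longleftrightarrow> \<psi>) = (sub \<sigma> \<tau> \<phi> \<^bold>\<longleftrightarrow> sub \<sigma> \<tau> \<psi>)"
  by (simp_all add: Iff_def)

lemma ren_seq_eq [simp]: "ren r q (seq_eq a b) = seq_eq (ren_s r q a) (ren_s r q b)"
  and sub_seq_eq [simp]: "sub \<sigma> \<tau> (seq_eq a b) = seq_eq (sub_s \<sigma> \<tau> a) (sub_s \<sigma> \<tau> b)"
  by (simp_all add: seq_eq_def)

lemma ren_apart [simp]: "ren r q (apart a b) = apart (ren_s r q a) (ren_s r q b)"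
  and sub_apart [simp]: "sub \<sigma> \<tau> (apart a b) = apart (sub_s \<sigma> \<tau> a) (sub_s \<sigma> \<tau> b)"
  by (simp_all add: apart_def)

lemma ren_spread_law [simp]: "ren r q (spread_law a) = spread_law (ren_s r q a)"
  by (simp add: spread_law_def)

lemma ren_in_spread [simp]: "ren r q (in_spread a b) = in_spread (ren_s r q a) (ren_s r q b)"
  and sub_in_spread [simp]: "sub \<sigma> \<tau> (in_spread a b) = in_spread (sub_s \<sigma> \<tau> a) (sub_s \<sigma> \<tau> b)"
  by (simp_all add: in_spread_def)

lemma ren_num_value [simp]:
    "ren r q (num_value g a p) = num_value (ren_s r q g) (ren_s r q a) (ren_n r q p)"
  and sub_num_value [simp]:
    "sub \<sigma> \<tau> (num_value g a p) = num_value (sub_s \<sigma> \<tau> g) (sub_s \<sigma> \<tau> a) (sub_n \<sigma> \<tau> p)"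
  by (simp_all add: num_value_def)

lemma ren_fun_value [simp]:
    "ren r q (fun_value g a c) = fun_value (ren_s r q g) (ren_s r q a) (ren_s r q c)"
  and sub_fun_value [simp]:
    "sub \<sigma> \<tau> (fun_value g a c) = fun_value (sub_s \<sigma> \<tau> g) (sub_s \<sigma> \<tau> a) (sub_s \<sigma> \<tau> c)"
  by (simp_all add: fun_value_def)

lemma ren_codes_fun [simp]: "ren r q (codes_fun g b) = codes_fun (ren_s r q g) (ren_s r q b)"
  by (simp add: codes_fun_def)

lemma ren_in_D2A1 [simp]: "ren r q (in_D2A1 a) = in_D2A1 (ren_s r q a)"
  and sub_in_D2A1 [simp]: "sub \<sigma> \<tau> (in_D2A1 a) = in_D2A1 (sub_s \<sigma> \<tau> a)"
  by (simp_all add: in_D2A1_def)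

lemma ren_onto_D2A1 [simp]: "ren r q (onto_D2A1 g b) = onto_D2A1 (ren_s r q g) (ren_s r q b)"
  by (simp add: onto_D2A1_def)

section \<open>Structural and derived rules of the logic\<close>

lemma weaken: "\<Gamma> \<turnstile> \<phi> \<Longrightarrow> \<Gamma> \<subseteq> \<Delta> \<Longrightarrow> \<Delta> \<turnstile> \<phi>"
proof (induction arbitrary: \<Delta> rule: derivable.induct)
  case (OrE \<Gamma> \<phi> \<psi> \<chi>)
  then show ?case by (meson derivable.OrE insert_mono)
next
  case (ExNE \<Gamma> \<phi> \<chi>)
  then show ?case by (meson derivable.ExNE insert_mono image_mono)
next
  case (ExSE \<Gamma> \<phi> \<chi>)
  then show ?case by (meson derivable.ExSE insert_mono image_mono)
qed (blast intro: derivable.intros)+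

lemma weaken_closed: "{} \<turnstile> \<phi> \<Longrightarrow> \<Gamma> \<turnstile> \<phi>"
  by (rule weaken) auto

lemma weaken_insert: "\<Gamma> \<turnstile> \<phi> \<Longrightarrow> insert \<psi> \<Gamma> \<turnstile> \<phi>"
  by (rule weaken) auto

lemma assm_top: "insert \<phi> \<Gamma> \<turnstile> \<phi>"
  by (rule Assm) simp

lemma cut: "\<Gamma> \<turnstile> \<phi> \<Longrightarrow> insert \<phi> \<Gamma> \<turnstile> \<psi> \<Longrightarrow> \<Gamma> \<turnstile> \<psi>"
  by (blast intro: ImpI ImpE)

lemma NegI: "insert \<phi> \<Gamma> \<turnstile> Fls \<Longrightarrow> \<Gamma> \<turnstile> \<^bold>\<not> \<phi>"
  by (simp add: Neg_def ImpI)

lemma NegE: "\<Gamma> \<turnstile> \<^bold>\<not> \<phi> \<Longrightarrow> \<Gamma> \<turnstile> \<phi> \<Longrightarrow> \<Gamma> \<turnstile> \<chi>"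
  by (metis Neg_def ImpE FlsE)

lemma IffD1: "\<Gamma> \<turnstile> \<phi> \<^bold>\<longleftrightarrow> \<psi> \<Longrightarrow> \<Gamma> \<turnstile> \<phi> \<Longrightarrow> \<Gamma> \<turnstile> \<psi>"
  by (metis Iff_def ImpE AndE1)

lemma IffD2: "\<Gamma> \<turnstile> \<phi> \<^bold>\<longleftrightarrow> \<psi> \<Longrightarrow> \<Gamma> \<turnstile> \<psi> \<Longrightarrow> \<Gamma> \<turnstile> \<phi>"
  by (metis Iff_def ImpE AndE2)

lemma IffI: "insert \<phi> \<Gamma> \<turnstile> \<psi> \<Longrightarrow> insert \<psi> \<Gamma> \<turnstile> \<phi> \<Longrightarrow> \<Gamma> \<turnstile> \<phi> \<^bold>\<longleftrightarrow> \<psi>"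
  by (simp add: Iff_def AndI ImpI)

section \<open>Equality and congruence\<close>

lemma Eq_refl: "\<Gamma> \<turnstile> t \<^bold>= t"
  by (simp add: Ax ax.Refl)

lemma Eq_subst: "\<Gamma> \<turnstile> t \<^bold>= u \<Longrightarrow> \<Gamma> \<turnstile> instN t \<phi> \<Longrightarrow> \<Gamma> \<turnstile> instN u \<phi>"
  by (meson Ax ImpE ax.Leibniz)

lemma Eq_sym: "\<Gamma> \<turnstile> t \<^bold>= u \<Longrightarrow> \<Gamma> \<turnstile> u \<^bold>= t"
  using Eq_subst[of \<Gamma> t u "NVar 0 \<^bold>= wkN_n t"] by (simp add: Eq_refl)

lemma Eq_trans: "\<Gamma> \<turnstile> t \<^bold>= u \<Longrightarrow> \<Gamma> \<turnstile> u \<^bold>= v \<Longrightarrow> \<Gamma> \<turnstile> t \<^bold>= v"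
  using Eq_subst[of \<Gamma> u v "wkN_n t \<^bold>= NVar 0"] by simp

lemma Eq_cong:
  "\<Gamma> \<turnstile> t \<^bold>= u \<Longrightarrow> \<Gamma> \<turnstile> sub_n (case_nat t NVar) SVar c \<^bold>= sub_n (case_nat u NVar) SVar c"
  using Eq_subst[of \<Gamma> t u "wkN_n (sub_n (case_nat t NVar) SVar c) \<^bold>= c"]
  by (simp add: Eq_refl del: ren_sub_tm)

lemma Succ_cong: "\<Gamma> \<turnstile> t \<^bold>= u \<Longrightarrow> \<Gamma> \<turnstile> Succ t \<^bold>= Succ u"
  using Eq_cong[of \<Gamma> t u "Succ (NVar 0)"] by simp

lemma Ap_cong: "\<Gamma> \<turnstile> t \<^bold>= u \<Longrightarrow> \<Gamma> \<turnstile> Ap a t \<^bold>= Ap a u"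
  using Eq_cong[of \<Gamma> t u "Ap (wkN_s a) (NVar 0)"] by simp

lemma Rec_cong: "\<Gamma> \<turnstile> t \<^bold>= u \<Longrightarrow> \<Gamma> \<turnstile> Rec a b t \<^bold>= Rec a b u"
  using Eq_cong[of \<Gamma> t u "Rec (wkN_n a) (ren_n (up (up Suc)) id b) (NVar 0)"]
  by (simp add: upN_up[unfolded id_def] up_id case_nat_NVar)

lemma Cns_cong: "\<Gamma> \<turnstile> t \<^bold>= u \<Longrightarrow> \<Gamma> \<turnstile> s \<^bold>= v \<Longrightarrow> \<Gamma> \<turnstile> Cns t s \<^bold>= Cns u v"
  using Eq_cong[of \<Gamma> t u "Cns (NVar 0) (wkN_n s)"] Eq_cong[of \<Gamma> s v "Cns (wkN_n u) (NVar 0)"]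
  by (auto intro: Eq_trans)

lemma snoc_cong: "\<Gamma> \<turnstile> t \<^bold>= u \<Longrightarrow> \<Gamma> \<turnstile> s \<^bold>= v \<Longrightarrow> \<Gamma> \<turnstile> snoc t s \<^bold>= snoc u v"
  using Eq_cong[of \<Gamma> t u "snoc (NVar 0) (wkN_n s)"] Eq_cong[of \<Gamma> s v "snoc (wkN_n u) (NVar 0)"]
  by (auto intro: Eq_trans)

section \<open>Arithmetic: predecessor, decidable equality, order\<close>

lemma induct_N:
  assumes "\<Gamma> \<turnstile> instN Zero \<phi>"
    and "insert \<phi> (wkN ` \<Gamma>) \<turnstile> sub (case_nat (Succ (NVar 0)) (\<lambda>i. NVar (Suc i))) SVar \<phi>"
  shows "\<Gamma> \<turnstile> AllN \<phi>"
  by (rule ImpE[OF Ax[OF ax.Induction]], rule AndI[OF assms(1)], rule AllNI, rule ImpI, rule assms(2))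

lemma Succ_inj: "\<Gamma> \<turnstile> Succ t \<^bold>= Succ u \<Longrightarrow> \<Gamma> \<turnstile> t \<^bold>= u"
  by (rule ImpE[OF Ax[OF ax.Succ_inject]])

lemma Succ_neq_Zero: "\<Gamma> \<turnstile> Succ t \<^bold>= Zero \<Longrightarrow> \<Gamma> \<turnstile> \<chi>"
  by (rule NegE[OF Ax[OF ax.Succ_nonzero]])

lemma Zero_neq_Succ: "\<Gamma> \<turnstile> Zero \<^bold>= Succ t \<Longrightarrow> \<Gamma> \<turnstile> \<chi>"
  by (rule Succ_neq_Zero[OF Eq_sym])

text \<open>The recursion step returns the index, which is the predecessor. Having it as a term
  makes the distinction between zero and successor a disjunction of equations, with no existential
  quantifier and hence no renaming of the context.\<close>

definition pred_tm :: "ntm \<Rightarrow> ntm"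
  where "pred_tm t = Rec Zero (NVar 1) t"

lemma ren_pred_tm [simp]: "ren_n r q (pred_tm t) = pred_tm (ren_n r q t)"
  and sub_pred_tm [simp]: "sub_n \<sigma> \<tau> (pred_tm t) = pred_tm (sub_n \<sigma> \<tau> t)"
  by (simp_all add: pred_tm_def)

lemma pred_tm_Succ: "\<Gamma> \<turnstile> pred_tm (Succ t) \<^bold>= t"
  using Ax[OF ax.Rec_Succ[of Zero "NVar 1" t]] by (simp add: pred_tm_def)

lemma Plus_Zero: "\<Gamma> \<turnstile> Plus t Zero \<^bold>= t"
  unfolding Plus_def by (rule Ax[OF ax.Rec_Zero])

lemma Plus_Succ: "\<Gamma> \<turnstile> Plus t (Succ u) \<^bold>= Succ (Plus t u)"
  using Ax[OF ax.Rec_Succ[of t "Succ (NVar 0)" u]] by (simp add: Plus_def)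

lemma bar_Zero: "\<Gamma> \<turnstile> bar a Zero \<^bold>= Zero"
  unfolding bar_def by (rule Ax[OF ax.Rec_Zero])

lemma bar_Succ: "\<Gamma> \<turnstile> bar a (Succ n) \<^bold>= snoc (bar a n) (Ap a n)"
  using Ax[OF ax.Rec_Succ[of Zero "snoc (NVar 0) (Ap (wkN_s (wkN_s a)) (NVar 1))" n]]
  by (simp add: bar_def)

lemma Ap_sect: "\<Gamma> \<turnstile> Ap (sect a m) k \<^bold>= Ap a (Cns m k)"
  using Ax[OF ax.Beta[of "Ap (wkN_s a) (Cns (wkN_n m) (NVar 0))" k]] by (simp add: sect_def)

lemma Ap_zero_seq: "\<Gamma> \<turnstile> Ap zero_seq k \<^bold>= Zero"
  using Ax[OF ax.Beta[of Zero k]] by (simp add: zero_seq_def)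

lemma Plus_cong2: "\<Gamma> \<turnstile> u \<^bold>= v \<Longrightarrow> \<Gamma> \<turnstile> Plus t u \<^bold>= Plus t v"
  unfolding Plus_def by (rule Rec_cong)

lemma zero_or_succ: "\<Gamma> \<turnstile> (t \<^bold>= Zero) \<^bold>\<or> (t \<^bold>= Succ (pred_tm t))"
proof -
  have "\<Gamma> \<turnstile> AllN ((NVar 0 \<^bold>= Zero) \<^bold>\<or> (NVar 0 \<^bold>= Succ (pred_tm (NVar 0))))"
    by (rule induct_N) (auto intro: OrI1 OrI2 Eq_refl Succ_cong Eq_sym[OF pred_tm_Succ])
  from AllNE[OF this, of t] show ?thesis by simp
qed

lemma nat_cases:
  assumes "insert (t \<^bold>= Zero) \<Gamma> \<turnstile> \<chi>" and "insert (t \<^bold>= Succ (pred_tm t)) \<Gamma> \<turnstile> \<chi>"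
  shows "\<Gamma> \<turnstile> \<chi>"
  by (rule OrE[OF zero_or_succ assms])

text \<open>Used for statements about two numbers: \<open>u\<close> goes to the outer variable
  \<open>NVar 1\<close> and \<open>t\<close> to the inner variable \<open>NVar 0\<close>.\<close>

lemma AllN_AllN_E:
  "\<Gamma> \<turnstile> AllN (AllN \<phi>) \<Longrightarrow>
    \<Gamma> \<turnstile> instN t (sub (upN (case_nat u NVar)) (\<lambda>i. wkN_s (SVar i)) \<phi>)"
  using AllNE[of \<Gamma> "AllN \<phi>" u] by (intro AllNE) (simp del: subst_simps)

lemma Eq_dec: "\<Gamma> \<turnstile> (t \<^bold>= u) \<^bold>\<or> \<^bold>\<not> (t \<^bold>= u)"
proof -
  have "{} \<turnstile> AllN (AllN ((NVar 0 \<^bold>= NVar 1) \<^bold>\<or> \<^bold>\<not> (NVar 0 \<^bold>= NVar 1)))" (is "_ \<turnstile> AllN ?P")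
  proof (rule induct_N)
    have "{} \<turnstile> AllN ((NVar 0 \<^bold>= Zero) \<^bold>\<or> \<^bold>\<not> (NVar 0 \<^bold>= Zero))"
      by (rule AllNI, rule nat_cases[of "NVar 0"], rule OrI1[OF assm_top], rule OrI2, rule NegI,
          rule Succ_neq_Zero[of _ "pred_tm (NVar 0)"], rule Eq_trans[of _ _ "NVar 0"], rule Eq_sym)
        (simp_all add: Assm)
    then show "{} \<turnstile> instN Zero ?P" by simp
    \<comment> \<open>The induction hypothesis after weakening by the new variable
      \<open>?y\<close>: the induction variable is now \<open>NVar 1\<close>, and one more under the
      binder.\<close>
    let ?G = "{AllN ((NVar 0 \<^bold>= NVar (Suc (Suc 0))) \<^bold>\<or> \<^bold>\<not> (NVar 0 \<^bold>= NVar (Suc (Suc 0))))}"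
    let ?y = "NVar 0" and ?x = "NVar (Suc 0)"
    let ?Q = "(?y \<^bold>= Succ ?x) \<^bold>\<or> \<^bold>\<not> (?y \<^bold>= Succ ?x)"
    have "?G \<turnstile> ?Q"
    proof (rule nat_cases[of ?y])
      show "insert (?y \<^bold>= Zero) ?G \<turnstile> ?Q"
        by (rule OrI2, rule NegI, rule Zero_neq_Succ[of _ ?x], rule Eq_trans[of _ _ ?y], rule Eq_sym)
          (simp_all add: Assm)
      let ?G' = "insert (?y \<^bold>= Succ (pred_tm ?y)) ?G"
      have "?G' \<turnstile> (pred_tm ?y \<^bold>= ?x) \<^bold>\<or> \<^bold>\<not> (pred_tm ?y \<^bold>= ?x)"
        using AllNE[of ?G' "(NVar 0 \<^bold>= NVar (Suc (Suc 0))) \<^bold>\<or> \<^bold>\<not> (NVar 0 \<^bold>= NVar (Suc (Suc 0)))" "pred_tm ?y"]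
        by (simp add: Assm)
      then show "?G' \<turnstile> ?Q"
      proof (rule OrE)
        show "insert (pred_tm ?y \<^bold>= ?x) ?G' \<turnstile> ?Q"
          by (rule OrI1, rule Eq_trans[of _ _ "Succ (pred_tm ?y)"], simp add: Assm, rule Succ_cong)
             (simp add: Assm)
        show "insert (\<^bold>\<not> (pred_tm ?y \<^bold>= ?x)) ?G' \<turnstile> ?Q"
          by (rule OrI2, rule NegI, rule NegE[of _ "pred_tm ?y \<^bold>= ?x"], simp add: Assm, rule Succ_inj,
              rule Eq_trans[of _ _ ?y], rule Eq_sym) (simp_all add: Assm)
      qed
    qed
    then have "{?P} \<turnstile> AllN ?Q"
      by (intro AllNI) simp
    then show "insert ?P (wkN ` {}) \<turnstile> sub (case_nat (Succ (NVar 0)) (\<lambda>i. NVar (Suc i))) SVar ?P"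
      by simp
  qed
  from AllN_AllN_E[OF weaken_closed[OF this], of \<Gamma> t u] show ?thesis
    by simp
qed

lemma Zero_Plus: "\<Gamma> \<turnstile> Plus Zero u \<^bold>= u"
proof -
  have "\<Gamma> \<turnstile> AllN (Plus Zero (NVar 0) \<^bold>= NVar 0)"
    by (rule induct_N) (simp_all add: Plus_Zero Eq_trans[OF Plus_Succ] Succ_cong assm_top)
  from AllNE[OF this, of u] show ?thesis by simp
qed

lemma Succ_Plus: "\<Gamma> \<turnstile> Plus (Succ t) u \<^bold>= Succ (Plus t u)"
proof -
  have "\<Gamma> \<turnstile> AllN (Plus (Succ (wkN_n t)) (NVar 0) \<^bold>= Succ (Plus (wkN_n t) (NVar 0)))"
  proof (rule induct_N)
    show "\<Gamma> \<turnstile> instN Zero (Plus (Succ (wkN_n t)) (NVar 0) \<^bold>= Succ (Plus (wkN_n t) (NVar 0)))"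
      by (simp add: Eq_trans[OF Plus_Zero] Succ_cong Eq_sym[OF Plus_Zero])
  next
    let ?G = "insert (Plus (Succ (wkN_n t)) (NVar 0) \<^bold>= Succ (Plus (wkN_n t) (NVar 0))) (wkN ` \<Gamma>)"
    have "?G \<turnstile> Plus (Succ (wkN_n t)) (Succ (NVar 0)) \<^bold>= Succ (Plus (wkN_n t) (Succ (NVar 0)))"
      by (rule Eq_trans[OF Plus_Succ], rule Succ_cong, rule Eq_trans[OF assm_top],
          rule Eq_sym[OF Plus_Succ])
    then show "?G \<turnstile> sub (case_nat (Succ (NVar 0)) (\<lambda>i. NVar (Suc i))) SVar
        (Plus (Succ (wkN_n t)) (NVar 0) \<^bold>= Succ (Plus (wkN_n t) (NVar 0)))"
      by simp
  qed
  from AllNE[OF this, of u] show ?thesis by simp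
qed

lemma LessI: "\<Gamma> \<turnstile> Plus t (Succ k) \<^bold>= u \<Longrightarrow> \<Gamma> \<turnstile> Less t u"
  unfolding Less_def by (rule ExNI[of _ k]) simp

lemma LessE:
  assumes "\<Gamma> \<turnstile> Less t u"
    and "insert (Plus (wkN_n t) (Succ (NVar 0)) \<^bold>= wkN_n u) (wkN ` \<Gamma>) \<turnstile> wkN \<chi>"
  shows "\<Gamma> \<turnstile> \<chi>"
  using ExNE[OF assms(1)[unfolded Less_def] assms(2)] .

lemma not_Less_Zero: "\<Gamma> \<turnstile> Less t Zero \<Longrightarrow> \<Gamma> \<turnstile> \<chi>"
  by (rule FlsE, erule LessE, rule Succ_neq_Zero,
      rule Eq_trans[OF Eq_sym[OF Plus_Succ]], simp, rule assm_top)

text \<open>Cancelling a successor in t + (k+1) = u+1 gives t + k = u. The two alternatives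
  correspond to k being zero or a successor.\<close>

lemma Less_Succ_cases: "\<Gamma> \<turnstile> Less t (Succ u) \<Longrightarrow> \<Gamma> \<turnstile> Less t u \<^bold>\<or> (t \<^bold>= u)"
proof (erule LessE)
  let ?G = "insert (Plus (wkN_n t) (Succ (NVar 0)) \<^bold>= wkN_n (Succ u)) (wkN ` \<Gamma>)"
  have eq: "?G \<turnstile> Plus (wkN_n t) (NVar 0) \<^bold>= wkN_n u"
    by (rule Succ_inj, rule Eq_trans[OF Eq_sym[OF Plus_Succ]]) (simp add: Assm)
  have "?G \<turnstile> Less (wkN_n t) (wkN_n u) \<^bold>\<or> (wkN_n t \<^bold>= wkN_n u)"
    by (rule nat_cases[of "NVar 0"], rule OrI2,
        rule Eq_trans[OF Eq_trans[OF Eq_sym[OF Plus_Zero] Plus_cong2[OF Eq_sym[OF assm_top]]]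
          weaken_insert[OF eq]],
        rule OrI1, rule LessI,
        rule Eq_trans[OF Plus_cong2[OF Eq_sym[OF assm_top]] weaken_insert[OF eq]])
  then show "?G \<turnstile> wkN (Less t u \<^bold>\<or> (t \<^bold>= u))"
    by simp
qed

lemma Less_Zero_Succ: "\<Gamma> \<turnstile> Less Zero (Succ u)"
  by (rule LessI[OF Zero_Plus])

lemma Less_Succ_Succ: "\<Gamma> \<turnstile> Less t u \<Longrightarrow> \<Gamma> \<turnstile> Less (Succ t) (Succ u)"
  by (erule LessE, simp, rule LessI, rule Eq_trans[OF Succ_Plus], rule Succ_cong, rule assm_top)

lemma Less_cong:
  assumes "\<Gamma> \<turnstile> t \<^bold>= t'" and "\<Gamma> \<turnstile> u \<^bold>= u'" and "\<Gamma> \<turnstile> Less t u"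
  shows "\<Gamma> \<turnstile> Less t' u'"
  using Eq_subst[OF assms(1), of "Less (NVar 0) (wkN_n u)"]
    Eq_subst[OF assms(2), of "Less (wkN_n t') (NVar 0)"] assms(3) by simp

text \<open>The same scheme as for \<open>Eq_dec\<close>: comparing a positive y with x+1 amounts to
  comparing the predecessor of y with x.\<close>

lemma Less_trichotomy: "\<Gamma> \<turnstile> Less t u \<^bold>\<or> (t \<^bold>= u) \<^bold>\<or> Less u t"
proof -
  let ?T = "\<lambda>t u. Less t u \<^bold>\<or> (t \<^bold>= u) \<^bold>\<or> Less u t"
  let ?P = "AllN (?T (NVar 0) (NVar 1))"
  have "{} \<turnstile> AllN ?P"
  proof (rule induct_N)
    have "{} \<turnstile> ?T (NVar 0) Zero"
      by (rule nat_cases[of "NVar 0"], rule OrI2, rule OrI1, rule assm_top,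
          rule OrI2, rule OrI2, rule Less_cong[OF Eq_refl Eq_sym[OF assm_top] Less_Zero_Succ])
    then show "{} \<turnstile> instN Zero ?P" by (simp add: AllNI)
  next
    let ?y = "NVar 0" and ?x = "NVar (Suc 0)"
    let ?G = "{AllN (?T (NVar 0) (NVar (Suc (Suc 0))))}"
    have "?G \<turnstile> ?T ?y (Succ ?x)"
    proof (rule nat_cases[of ?y])
      show "insert (?y \<^bold>= Zero) ?G \<turnstile> ?T ?y (Succ ?x)"
        by (rule OrI1, rule Less_cong[OF Eq_sym[OF assm_top] Eq_refl Less_Zero_Succ])
      let ?H = "insert (?y \<^bold>= Succ (pred_tm ?y)) ?G"
      have "?H \<turnstile> ?T (pred_tm ?y) ?x"
        using AllNE[of ?H "?T (NVar 0) (NVar (Suc (Suc 0)))" "pred_tm ?y"] by (simp add: Assm)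
      then show "?H \<turnstile> ?T ?y (Succ ?x)"
      proof (rule OrE)
        let ?H' = "insert (Less (pred_tm ?y) ?x) ?H"
        have "?H' \<turnstile> Succ (pred_tm ?y) \<^bold>= ?y" by (rule Eq_sym) (simp add: Assm)
        from Less_cong[OF this Eq_refl Less_Succ_Succ[OF assm_top]]
        show "?H' \<turnstile> ?T ?y (Succ ?x)" by (rule OrI1)
      next
        let ?H' = "insert ((pred_tm ?y \<^bold>= ?x) \<^bold>\<or> Less ?x (pred_tm ?y)) ?H"
        show "?H' \<turnstile> ?T ?y (Succ ?x)"
        proof (rule OrE[OF assm_top], rule OrI2, rule OrI1)
          show "insert (pred_tm ?y \<^bold>= ?x) ?H' \<turnstile> ?y \<^bold>= Succ ?x"
            by (rule Eq_trans[of _ _ "Succ (pred_tm ?y)"], simp add: Assm, rule Succ_cong[OF assm_top])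
          let ?K = "insert (Less ?x (pred_tm ?y)) ?H'"
          have "?K \<turnstile> Succ (pred_tm ?y) \<^bold>= ?y" by (rule Eq_sym) (simp add: Assm)
          from Less_cong[OF Eq_refl this Less_Succ_Succ[OF assm_top]]
          show "?K \<turnstile> ?T ?y (Succ ?x)" by (intro OrI2)
        qed
      qed
    qed
    then have "{?P} \<turnstile> AllN (?T ?y (Succ ?x))" by (intro AllNI) simp
    then show "insert ?P (wkN ` {}) \<turnstile> sub (case_nat (Succ (NVar 0)) (\<lambda>i. NVar (Suc i))) SVar ?P"
      by simp
  qed
  from AllN_AllN_E[OF weaken_closed[OF this], of \<Gamma> t u] show ?thesis
    by simp
qed

section \<open>Existence and uniqueness of the values of a coded function\<close>

lemma num_valueI:
  assumes "\<Gamma> \<turnstile> Ap g (bar a m) \<^bold>= Succ p"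
    and "\<Gamma> \<turnstile> AllN (Less (NVar 0) (wkN_n m) \<^bold>\<longrightarrow> Ap (wkN_s g) (bar (wkN_s a) (NVar 0)) \<^bold>= Zero)"
  shows "\<Gamma> \<turnstile> num_value g a p"
  unfolding num_value_def
  by (rule ExNI[of _ m]) (use assms in \<open>simp add: AndI\<close>)

text \<open>A bounded search for the first nonzero value. By induction on n, either all values at
  initial segments shorter than n are zero or a first nonzero value has been found; each step is
  decided by the distinction between zero and successor.\<close>

lemma num_value_exists:
  assumes "\<Gamma> \<turnstile> \<^bold>\<not> (Ap g (bar a m) \<^bold>= Zero)"
  shows "\<Gamma> \<turnstile> ExN (num_value (wkN_s g) (wkN_s a) (NVar 0))"
proof -
  let ?g = "wkN_s g" and ?a = "wkN_s a"
  let ?Z = "\<lambda>g a m. AllN (Less (NVar 0) (wkN_n m) \<^bold>\<longrightarrow> Ap (wkN_s g) (bar (wkN_s a) (NVar 0)) \<^bold>= Zero)"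
  let ?E = "\<lambda>g a. ExN (num_value (wkN_s g) (wkN_s a) (NVar 0))"
  let ?P = "?Z ?g ?a (NVar 0) \<^bold>\<or> ?E ?g ?a"
  \<comment> \<open>Stated for arbitrary terms and contexts, since the induction uses it for
    weakened ones.\<close>
  have step: "insert (?Z g a n) \<Delta> \<turnstile> ?Z g a (Succ n) \<^bold>\<or> ?E g a" for \<Delta> g a n
  proof (rule nat_cases[of "Ap g (bar a n)"])
    let ?G = "insert (Ap g (bar a n) \<^bold>= Zero) (insert (?Z g a n) \<Delta>)"
    let ?H = "insert (Less (NVar 0) (Succ (wkN_n n))) (wkN ` ?G)"
    let ?g = "wkN_s g" and ?a = "wkN_s a"
    have "?H \<turnstile> Ap ?g (bar ?a (NVar 0)) \<^bold>= Zero"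
    proof (rule OrE[OF Less_Succ_cases[OF assm_top]])
      let ?K = "insert (Less (NVar 0) (wkN_n n)) ?H"
      have "?K \<turnstile> wkN (?Z g a n)" by (rule Assm) simp
      from AllNE[OF this[unfolded ren.simps], of "NVar 0"]
      show "?K \<turnstile> Ap ?g (bar ?a (NVar 0)) \<^bold>= Zero"
        by (simp add: ImpE[OF _ assm_top])
    next
      let ?K = "insert (NVar 0 \<^bold>= wkN_n n) ?H"
      have "?K \<turnstile> instN (wkN_n n) (Ap (wkN_s ?g) (bar (wkN_s ?a) (NVar 0)) \<^bold>= Zero)"
        by (simp add: Assm)
      from Eq_subst[OF Eq_sym[OF assm_top] this]
      show "?K \<turnstile> Ap ?g (bar ?a (NVar 0)) \<^bold>= Zero"
        by simp
    qed
    then have "wkN ` ?G \<turnstile> Less (NVar 0) (Succ (wkN_n n)) \<^bold>\<longrightarrow> Ap ?g (bar ?a (NVar 0)) \<^bold>= Zero"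
      by (rule ImpI)
    from AllNI[OF this] show "?G \<turnstile> ?Z g a (Succ n) \<^bold>\<or> ?E g a"
      by (simp add: OrI1)
  next
    let ?G = "insert (Ap g (bar a n) \<^bold>= Succ (pred_tm (Ap g (bar a n)))) (insert (?Z g a n) \<Delta>)"
    have "?G \<turnstile> num_value g a (pred_tm (Ap g (bar a n)))"
      by (rule num_valueI[OF assm_top]) (simp add: Assm)
    then have "?G \<turnstile> ?E g a"
      by (intro ExNI[of _ "pred_tm (Ap g (bar a n))"]) simp
    then show "?G \<turnstile> ?Z g a (Succ n) \<^bold>\<or> ?E g a"
      by (rule OrI2)
  qed
  have "\<Gamma> \<turnstile> AllN ?P"
  proof (rule induct_N)
    have "insert (Less (NVar 0) Zero) (wkN ` \<Gamma>) \<turnstile> Ap ?g (bar ?a (NVar 0)) \<^bold>= Zero"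
      by (rule not_Less_Zero[OF assm_top])
    from OrI1[OF AllNI[OF ImpI[OF this]]] show "\<Gamma> \<turnstile> instN Zero ?P" by simp
  next
    have "insert ?P (wkN ` \<Gamma>) \<turnstile> ?Z ?g ?a (Succ (NVar 0)) \<^bold>\<or> ?E ?g ?a"
      by (rule OrE[OF assm_top step OrI2[OF assm_top]])
    then show "insert ?P (wkN ` \<Gamma>) \<turnstile> sub (case_nat (Succ (NVar 0)) (\<lambda>i. NVar (Suc i))) SVar ?P"
      by simp
  qed
  \<comment> \<open>The bound is \<open>Succ m\<close>, so that \<open>m\<close> itself lies below
    it and the first alternative contradicts the assumption.\<close>
  from AllNE[OF this, of "Succ m"] have "\<Gamma> \<turnstile> ?Z g a (Succ m) \<^bold>\<or> ?E g a"
    by simp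
  then show ?thesis
  proof (rule OrE[OF _ _ assm_top])
    let ?H = "insert (?Z g a (Succ m)) \<Gamma>"
    have "?H \<turnstile> Less m (Succ m)"
      by (rule LessI[OF Eq_trans[OF Plus_Succ Succ_cong[OF Plus_Zero]]])
    moreover have "?H \<turnstile> Less m (Succ m) \<^bold>\<longrightarrow> Ap g (bar a m) \<^bold>= Zero"
      using AllNE[OF assm_top[of "?Z g a (Succ m)" \<Gamma>], of m] by simp
    ultimately have "?H \<turnstile> Ap g (bar a m) \<^bold>= Zero" by (rule ImpE[rotated])
    then show "?H \<turnstile> ?E g a" by (rule NegE[OF weaken_insert[OF assms]])
  qed
qed

text \<open>Two witnessing positions must coincide: by trichotomy one would otherwise be smaller,
  and the value there would be both a successor and zero.\<close>

lemma num_value_unique: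
  assumes "\<Gamma> \<turnstile> num_value g a p" and "\<Gamma> \<turnstile> num_value g a p'"
  shows "\<Gamma> \<turnstile> p \<^bold>= p'"
proof -
  let ?Z = "\<lambda>g a m. AllN (Less (NVar 0) (wkN_n m) \<^bold>\<longrightarrow> Ap (wkN_s g) (bar (wkN_s a) (NVar 0)) \<^bold>= Zero)"
  let ?V = "\<lambda>g a p m. (Ap g (bar a m) \<^bold>= Succ p) \<^bold>\<and> ?Z g a m"
  have less: "\<Delta> \<turnstile> \<chi>" if "\<Delta> \<turnstile> ?V g a p m" "\<Delta> \<turnstile> ?V g a p' m'" "\<Delta> \<turnstile> Less m m'"
    for \<Delta> g a p p' m m' \<chi>
  proof -
    have "\<Delta> \<turnstile> Ap g (bar a m) \<^bold>= Zero"
      by (rule ImpE[OF _ that(3)]) (use AllNE[OF AndE2[OF that(2)], of m] in simp)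
    from Eq_trans[OF Eq_sym[OF AndE1[OF that(1)]] this] show ?thesis
      by (rule Succ_neq_Zero)
  qed
  have core: "\<Delta> \<turnstile> p \<^bold>= p'" if V: "\<Delta> \<turnstile> ?V g a p m" "\<Delta> \<turnstile> ?V g a p' m'"
    for \<Delta> g a p p' m m'
  proof (rule OrE[OF Less_trichotomy[of _ m m']])
    show "insert (Less m m') \<Delta> \<turnstile> p \<^bold>= p'"
      by (rule less[OF weaken_insert[OF V(1)] weaken_insert[OF V(2)] assm_top])
    let ?H = "insert ((m \<^bold>= m') \<^bold>\<or> Less m' m) \<Delta>"
    note W = V[THEN weaken_insert, THEN weaken_insert]
    show "?H \<turnstile> p \<^bold>= p'"
    proof (rule OrE[OF assm_top])
      have "insert (m \<^bold>= m') ?H \<turnstile> Ap g (bar a m) \<^bold>= Ap g (bar a m')"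
        using Eq_cong[OF assm_top, of m m' ?H "Ap (wkN_s g) (bar (wkN_s a) (NVar 0))"] by simp
      from Eq_trans[OF Eq_trans[OF Eq_sym[OF AndE1[OF W(1)]] this] AndE1[OF W(2)]]
      show "insert (m \<^bold>= m') ?H \<turnstile> p \<^bold>= p'"
        by (rule Succ_inj)
      show "insert (Less m' m) ?H \<turnstile> p \<^bold>= p'"
        by (rule less[OF W(2,1) assm_top])
    qed
  qed
  \<comment> \<open>\<open>core\<close> treats the two positions as given terms. Eliminating both
    existential quantifiers weakens everything twice; the first position is then
    \<open>NVar 1\<close> and the second \<open>NVar 0\<close>.\<close>
  let ?w = "ren_s (\<lambda>i. Suc (Suc i)) (\<lambda>i. i)" and ?v = "ren_n (\<lambda>i. Suc (Suc i)) (\<lambda>i. i)"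
  let ?V1 = "?V (wkN_s g) (wkN_s a) (wkN_n p) (NVar 0)"
    and ?V2 = "?V (wkN_s g) (wkN_s a) (wkN_n p') (NVar 0)"
  have V1: "num_value g a p = ExN ?V1" and V2: "num_value g a p' = ExN ?V2"
    by (simp_all add: num_value_def)
  let ?N2 = "num_value g a p'"
  let ?H = "insert ?V1 (wkN ` insert ?N2 \<Gamma>)"
  let ?K = "insert (?V (?w g) (?w a) (?v p') (NVar 0)) (wkN ` ?H)"
  have "?K \<turnstile> ?v p \<^bold>= ?v p'"
    by (rule core[where g = "?w g" and a = "?w a" and m = "NVar (Suc 0)" and m' = "NVar 0"]) (rule Assm, simp)+
  then have "?H \<turnstile> wkN (p \<^bold>= p')"
    by (rule_tac ExNE[of ?H "?V (?w g) (?w a) (?v p') (NVar 0)"])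
       (simp_all add: Assm V2)
  then have "insert ?N2 \<Gamma> \<turnstile> p \<^bold>= p'"
    by (rule ExNE[OF weaken_insert[OF assms(1)[unfolded V1]]])
  then show ?thesis by (rule cut[OF assms(2)])
qed

lemma fun_value_unique:
  assumes "\<Gamma> \<turnstile> fun_value g a c" and "\<Gamma> \<turnstile> fun_value g a c'"
  shows "\<Gamma> \<turnstile> Ap c n \<^bold>= Ap c' n"
  by (rule num_value_unique[of _ "sect g n" a])
     (use AllNE[OF assms(1)[unfolded fun_value_def], of n]
        AllNE[OF assms(2)[unfolded fun_value_def], of n] in simp_all)

text \<open>The code provides, for each n, some nonzero value of its n-th section along
  \<open>a\<close>, hence a first one. Countable choice collects the resulting numbers into one
  sequence.\<close>

lemma fun_value_exists:
  assumes "\<Gamma> \<turnstile> codes_fun g b" and "\<Gamma> \<turnstile> in_spread b a"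
  shows "\<Gamma> \<turnstile> ExS (fun_value (wkS_s g) (wkS_s a) (SVar 0))"
proof -
  let ?G = "{codes_fun g b, in_spread b a}"
  let ?g = "wkN_s g" and ?a = "wkN_s a"
  let ?\<phi> = "num_value (sect (wkN_s ?g) (NVar 1)) (wkN_s ?a) (NVar 0)"
  have "wkN ` ?G \<turnstile> AllS (in_spread (wkS_s (wkN_s b)) (SVar 0) \<^bold>\<longrightarrow>
      ExN (\<^bold>\<not> (Ap (sect (wkN_s (wkS_s ?g)) (NVar 1)) (bar (SVar 0) (NVar 0)) \<^bold>= Zero)))"
    using AllNE[OF Assm[of "codes_fun ?g (wkN_s b)" "wkN ` ?G", unfolded codes_fun_def], of "NVar 0"]
    by (simp add: codes_fun_def)
  from AllSE[OF this, of ?a]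
  have "wkN ` ?G \<turnstile> in_spread (wkN_s b) ?a \<^bold>\<longrightarrow>
      ExN (\<^bold>\<not> (Ap (sect (wkN_s ?g) (NVar 1)) (bar (wkN_s ?a) (NVar 0)) \<^bold>= Zero))"
    by simp
  then have ex: "wkN ` ?G \<turnstile> ExN (\<^bold>\<not> (Ap (sect (wkN_s ?g) (NVar 1)) (bar (wkN_s ?a) (NVar 0)) \<^bold>= Zero))"
    by (rule ImpE) (simp add: Assm)
  have "wkN ` ?G \<turnstile> ExN ?\<phi>"
    by (rule ExNE[OF ex], use num_value_exists[OF assm_top, of "sect (wkN_s ?g) (NVar 1)" "wkN_s ?a" "NVar 0"] in simp)
  then have "?G \<turnstile> AllN (ExN ?\<phi>)"
    by (rule AllNI)
  \<comment> \<open>The body of the conclusion of \<open>AC00\<close> is exactly the unfolded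
    \<open>fun_value\<close>, with the chosen sequence as \<open>SVar 0\<close>.\<close>
  from ImpE[OF Ax[OF ax.AC00] this]
  have "?G \<turnstile> ExS (fun_value (wkS_s g) (wkS_s a) (SVar 0))"
    by (simp add: fun_value_def)
  from weaken[OF this, of "insert (codes_fun g b) (insert (in_spread b a) \<Gamma>)"]
  show ?thesis
    by (intro cut[OF assms(2)] cut[OF weaken_insert[OF assms(1)]]) auto
qed

section \<open>Initial segments, apartness, and nonzero sequences near zero\<close>

text \<open>The constructive source of apartness: finitely many entries can be compared one after
  another by \<open>Eq_dec\<close>, and the first difference found is a witness.\<close>

lemma bar_eq_or_apart: "\<Gamma> \<turnstile> (bar a n \<^bold>= bar b n) \<^bold>\<or> apart a b"
proof -
  let ?P = "\<lambda>a b n. (bar a n \<^bold>= bar b n) \<^bold>\<or> apart a b"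
  have "\<Gamma> \<turnstile> AllN (?P (wkN_s a) (wkN_s b) (NVar 0))"
  proof (rule induct_N)
    show "\<Gamma> \<turnstile> instN Zero (?P (wkN_s a) (wkN_s b) (NVar 0))"
      using OrI1[OF Eq_trans[OF bar_Zero Eq_sym[OF bar_Zero]]] by simp
    have step: "insert (?P a b n) \<Delta> \<turnstile> ?P a b (Succ n)" for a b n \<Delta>
    proof (rule OrE[OF assm_top _ OrI2[OF assm_top]], rule OrE[OF Eq_dec])
      let ?H = "insert (bar a n \<^bold>= bar b n) (insert (?P a b n) \<Delta>)"
      let ?K = "insert (Ap a n \<^bold>= Ap b n) ?H"
      have "?K \<turnstile> bar a n \<^bold>= bar b n" by (simp add: Assm)
      from Eq_trans[OF Eq_trans[OF bar_Succ snoc_cong[OF this assm_top]] Eq_sym[OF bar_Succ]]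
      show "?K \<turnstile> ?P a b (Succ n)" by (rule OrI1)
      show "insert (\<^bold>\<not> (Ap a n \<^bold>= Ap b n)) ?H \<turnstile> ?P a b (Succ n)"
        by (rule OrI2, unfold apart_def, rule ExNI[of _ n]) (simp add: Assm)
    qed
    then show "insert (?P (wkN_s a) (wkN_s b) (NVar 0)) (wkN ` \<Gamma>) \<turnstile>
        sub (case_nat (Succ (NVar 0)) (\<lambda>i. NVar (Suc i))) SVar (?P (wkN_s a) (wkN_s b) (NVar 0))"
      by simp
  qed
  from AllNE[OF this, of n] show ?thesis by simp
qed

text \<open>\<open>bar\<close> grows at its right end, while this splits off the first entry;
  induction with \<open>Append_Cns\<close> moves the new last entry past it. The assumptions hold in
  every context, and the second one for weakened sequences, because they are applied inside the
  induction.\<close>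

lemma bar_Succ_Cns:
  assumes zero: "\<And>\<Delta>. \<Delta> \<turnstile> Ap c Zero \<^bold>= Zero"
    and succ: "\<And>\<Delta> n. \<Delta> \<turnstile> Ap (wkN_s c) (Succ n) \<^bold>= Ap (wkN_s a) n"
  shows "\<Gamma> \<turnstile> bar c (Succ n) \<^bold>= Cns Zero (bar a n)"
proof -
  let ?P = "\<lambda>c a n. bar c (Succ n) \<^bold>= Cns Zero (bar a n)"
  have "\<Gamma> \<turnstile> AllN (?P (wkN_s c) (wkN_s a) (NVar 0))"
  proof (rule induct_N)
    have "\<Gamma> \<turnstile> snoc Zero Zero \<^bold>= Cns Zero Zero"
      unfolding snoc_def by (rule Ax[OF ax.Append_Zero])
    from Eq_trans[OF Eq_trans[OF bar_Succ snoc_cong[OF bar_Zero zero]] this]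
    have "\<Gamma> \<turnstile> bar c (Succ Zero) \<^bold>= Cns Zero Zero" .
    from Eq_trans[OF this Cns_cong[OF Eq_refl Eq_sym[OF bar_Zero]]]
    show "\<Gamma> \<turnstile> instN Zero (?P (wkN_s c) (wkN_s a) (NVar 0))" by simp
    let ?a = "wkN_s a" and ?c = "wkN_s c" and ?n = "NVar 0"
    let ?H = "insert (?P ?c ?a ?n) (wkN ` \<Gamma>)"
    have "?H \<turnstile> snoc (Cns Zero (bar ?a ?n)) (Ap ?a ?n) \<^bold>= Cns Zero (snoc (bar ?a ?n) (Ap ?a ?n))"
      unfolding snoc_def by (rule Ax[OF ax.Append_Cns])
    from Eq_trans[OF Eq_trans[OF bar_Succ snoc_cong[OF assm_top succ]] this]
    have "?H \<turnstile> bar ?c (Succ (Succ ?n)) \<^bold>= Cns Zero (snoc (bar ?a ?n) (Ap ?a ?n))" .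
    from Eq_trans[OF this Cns_cong[OF Eq_refl Eq_sym[OF bar_Succ]]]
    show "?H \<turnstile> sub (case_nat (Succ (NVar 0)) (\<lambda>i. NVar (Suc i))) SVar (?P ?c ?a ?n)" by simp
  qed
  from AllNE[OF this, of n] show ?thesis by simp
qed

text \<open>\<open>shift a\<close> is the sequence \<open>0, a(0), a(1), \<dots>\<close>.\<close>

definition shift :: "stm \<Rightarrow> stm"
  where "shift a = Lam (Rec Zero (Ap (wkN_s (wkN_s (wkN_s a))) (NVar 1)) (NVar 0))"

lemma ren_shift [simp]: "ren_s r q (shift a) = shift (ren_s r q a)"
  and sub_shift [simp]: "sub_s \<sigma> \<tau> (shift a) = shift (sub_s \<sigma> \<tau> a)"
  by (simp_all add: shift_def)

lemma Ap_shift: "\<Gamma> \<turnstile> Ap (shift a) n \<^bold>= Rec Zero (Ap (wkN_s (wkN_s a)) (NVar 1)) n"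
  using Ax[OF ax.Beta[of "Rec Zero (Ap (wkN_s (wkN_s (wkN_s a))) (NVar 1)) (NVar 0)" n]]
  by (simp add: shift_def)

lemma Ap_shift_Zero: "\<Gamma> \<turnstile> Ap (shift a) Zero \<^bold>= Zero"
  by (rule Eq_trans[OF Ap_shift Ax[OF ax.Rec_Zero]])

lemma Ap_shift_Succ: "\<Gamma> \<turnstile> Ap (shift a) (Succ n) \<^bold>= Ap a n"
  using Ax[OF ax.Rec_Succ[of Zero "Ap (wkN_s (wkN_s a)) (NVar 1)" n]]
  by (intro Eq_trans[OF Ap_shift]) simp

text \<open>Induction on \<open>k\<close>. The constant sequence 1 serves for length 0, and
  \<open>shift\<close> lengthens the initial run of zeros by one while moving the nonzero entry one
  place to the right.\<close>

lemma near_zero_seq: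
  "\<Gamma> \<turnstile> ExS ((bar (SVar 0) (wkS_n k) \<^bold>= bar zero_seq (wkS_n k)) \<^bold>\<and>
    ExN (\<^bold>\<not> (Ap (SVar 0) (NVar 0) \<^bold>= Zero)))"
proof -
  let ?Q = "\<lambda>a k. (bar a k \<^bold>= bar zero_seq k) \<^bold>\<and> ExN (\<^bold>\<not> (Ap (wkN_s a) (NVar 0) \<^bold>= Zero))"
  have "{} \<turnstile> AllN (ExS (?Q (SVar 0) (NVar 0)))"
  proof (rule induct_N)
    let ?one = "Lam (Succ Zero)"
    have one: "\<Gamma> \<turnstile> Ap ?one Zero \<^bold>= Succ Zero" for \<Gamma>
      using Ax[OF ax.Beta[of "Succ Zero" Zero]] by simp
    have "{} \<turnstile> \<^bold>\<not> (Ap ?one Zero \<^bold>= Zero)"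
      by (rule NegI, rule Succ_neq_Zero[OF Eq_trans[OF Eq_sym[OF one] assm_top]])
    then have "{} \<turnstile> ?Q ?one Zero"
      by (intro AndI Eq_trans[OF bar_Zero Eq_sym[OF bar_Zero]] ExNI[of _ Zero]) simp
    then show "{} \<turnstile> instN Zero (ExS (?Q (SVar 0) (NVar 0)))"
      by (simp, intro ExSI[of _ ?one]) simp
    let ?H = "{?Q (SVar 0) (NVar 0), ExS (?Q (SVar 0) (NVar 0))}"
    have Q: "?H \<turnstile> ?Q (SVar 0) (NVar 0)" by (rule assm_top)
    have "?H \<turnstile> bar (shift (SVar 0)) (Succ (NVar 0)) \<^bold>= Cns Zero (bar (SVar 0) (NVar 0))"
      by (rule bar_Succ_Cns) (simp_all add: Ap_shift_Zero Ap_shift_Succ)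
    from Eq_trans[OF this Cns_cong[OF Eq_refl AndE1[OF Q]]]
    have "?H \<turnstile> bar (shift (SVar 0)) (Succ (NVar 0)) \<^bold>= Cns Zero (bar zero_seq (NVar 0))" .
    moreover have "?H \<turnstile> Cns Zero (bar zero_seq (NVar 0)) \<^bold>= bar zero_seq (Succ (NVar 0))"
      by (rule Eq_sym, rule bar_Succ_Cns)
         (simp_all add: Ap_zero_seq Eq_trans[OF Ap_zero_seq Eq_sym[OF Ap_zero_seq]])
    ultimately have 1: "?H \<turnstile> bar (shift (SVar 0)) (Succ (NVar 0)) \<^bold>= bar zero_seq (Succ (NVar 0))"
      by (rule Eq_trans)
    let ?K = "insert (\<^bold>\<not> (Ap (SVar 0) (NVar 0) \<^bold>= Zero)) (wkN ` ?H)"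
    have "?K \<turnstile> \<^bold>\<not> (Ap (shift (SVar 0)) (Succ (NVar 0)) \<^bold>= Zero)"
      by (rule NegI, rule NegE[OF weaken_insert[OF assm_top]],
          rule Eq_trans[OF Eq_sym[OF Ap_shift_Succ] assm_top])
    then have "?K \<turnstile> wkN (ExN (\<^bold>\<not> (Ap (shift (SVar 0)) (NVar 0) \<^bold>= Zero)))"
      by (simp, intro ExNI[of _ "Succ (NVar 0)"]) simp
    moreover have "?H \<turnstile> ExN (\<^bold>\<not> (Ap (SVar 0) (NVar 0) \<^bold>= Zero))"
      using AndE2[OF Q] by simp
    ultimately have "?H \<turnstile> ExN (\<^bold>\<not> (Ap (shift (SVar 0)) (NVar 0) \<^bold>= Zero))"
      by (rule ExNE[rotated])
    with 1 have "?H \<turnstile> ?Q (shift (SVar 0)) (Succ (NVar 0))"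
      by (simp add: AndI)
    then have "?H \<turnstile> ExS (?Q (SVar 0) (Succ (NVar 0)))"
      by (intro ExSI[of _ "shift (SVar 0)"]) simp
    then have "{ExS (?Q (SVar 0) (NVar 0))} \<turnstile> ExS (?Q (SVar 0) (Succ (NVar 0)))"
      by (rule_tac ExSE[OF assm_top]) simp
    then show "insert (ExS (?Q (SVar 0) (NVar 0))) (wkN ` {}) \<turnstile>
        sub (case_nat (Succ (NVar 0)) (\<lambda>i. NVar (Suc i))) SVar (ExS (?Q (SVar 0) (NVar 0)))"
      by simp
  qed
  from AllNE[OF weaken_closed[OF this], of \<Gamma> k] show ?thesis by simp
qed

text \<open>Rules with an eigenvariable rename the whole context. A rule about an arbitrary context is
  therefore first derived in the finite context of its premises, and then transferred.\<close>

lemma cut_set: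
  assumes "finite \<Delta>" and "\<Delta> \<turnstile> \<psi>" and "\<And>\<phi>. \<phi> \<in> \<Delta> \<Longrightarrow> \<Gamma> \<turnstile> \<phi>"
  shows "\<Gamma> \<turnstile> \<psi>"
proof -
  have "\<Gamma> \<union> \<Delta> \<turnstile> \<psi>" using assms(2) by (rule weaken) auto
  with assms(1,3) show ?thesis
  proof (induction \<Delta> rule: finite_induct)
    case (insert \<phi> \<Delta>)
    have "\<Gamma> \<turnstile> \<phi>" by (rule insert.prems(1)) simp
    then have "\<Gamma> \<union> \<Delta> \<turnstile> \<phi>" by (rule weaken) simp
    moreover have "insert \<phi> (\<Gamma> \<union> \<Delta>) \<turnstile> \<psi>" using insert.prems(2) by simp
    ultimately have "\<Gamma> \<union> \<Delta> \<turnstile> \<psi>" by (rule cut)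
    with insert.IH insert.prems(1) show ?case by blast
  qed simp
qed

section \<open>Elements of D^2(A_1) with one prescribed section\<close>

text \<open>The index is a truth value of the metalanguage, so that the two symmetric cases share
  their lemmas and are split only outside the formal theory.\<close>

definition idx :: "bool \<Rightarrow> ntm"
  where "idx k = (if k then Succ Zero else Zero)"

lemma ren_idx [simp]: "ren_n r q (idx k) = idx k"
  and sub_idx [simp]: "sub_n \<sigma> \<tau> (idx k) = idx k"
  by (simp_all add: idx_def)

text \<open>Among the sections 0 and 1 of \<open>put k a\<close>, the one with index \<open>idx k\<close> is \<open>a\<close> and the other is zero.
  For \<open>k\<close> true all later sections are \<open>a\<close> as well, which is harmless.\<close>

definition put :: "bool \<Rightarrow> stm \<Rightarrow> stm"
  where "put k a =
    (if k then Lam (Rec Zero (Ap (wkN_s (wkN_s (wkN_s a))) (Tl (NVar 2))) (Hd (NVar 0)))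
     else Lam (Rec (Ap (wkN_s a) (Tl (NVar 0))) Zero (Hd (NVar 0))))"

lemma ren_put [simp]: "ren_s r q (put k a) = put k (ren_s r q a)"
  and sub_put [simp]: "sub_s \<sigma> \<tau> (put k a) = put k (sub_s \<sigma> \<tau> a)"
  by (simp_all add: put_def)

lemma Ap_put_True:
  "\<Gamma> \<turnstile> Ap (put True a) x \<^bold>= Rec Zero (Ap (wkN_s (wkN_s a)) (Tl (wkN_n (wkN_n x)))) (Hd x)"
  using Ax[OF ax.Beta[of "Rec Zero (Ap (wkN_s (wkN_s (wkN_s a))) (Tl (NVar 2))) (Hd (NVar 0))" x]]
  by (simp add: put_def)

lemma Ap_put_False: "\<Gamma> \<turnstile> Ap (put False a) x \<^bold>= Rec (Ap a (Tl x)) Zero (Hd x)"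
  using Ax[OF ax.Beta[of "Rec (Ap (wkN_s a) (Tl (NVar 0))) Zero (Hd (NVar 0))" x]]
  by (simp add: put_def)

lemma Ap_put_at:
  assumes "\<Gamma> \<turnstile> Hd x \<^bold>= idx k"
  shows "\<Gamma> \<turnstile> Ap (put k a) x \<^bold>= Ap a (Tl x)"
proof (cases k)
  case True
  let ?b = "Ap (wkN_s (wkN_s a)) (Tl (wkN_n (wkN_n x)))"
  have "\<Gamma> \<turnstile> Rec Zero ?b (Succ Zero) \<^bold>= Ap a (Tl x)"
    using Ax[OF ax.Rec_Succ[of Zero ?b Zero]] by simp
  moreover have "\<Gamma> \<turnstile> Hd x \<^bold>= Succ Zero"
    using assms True by (simp add: idx_def)
  ultimately have "\<Gamma> \<turnstile> Ap (put True a) x \<^bold>= Ap a (Tl x)"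
    using Eq_trans[OF Eq_trans[OF Ap_put_True Rec_cong]] by blast
  with True show ?thesis by simp
next
  case False
  then have "\<Gamma> \<turnstile> Hd x \<^bold>= Zero"
    using assms by (simp add: idx_def)
  from Eq_trans[OF Eq_trans[OF Ap_put_False Rec_cong[OF this]] Ax[OF ax.Rec_Zero]]
  have "\<Gamma> \<turnstile> Ap (put False a) x \<^bold>= Ap a (Tl x)" .
  with False show ?thesis by simp
qed

lemma Ap_put_False_Succ:
  assumes "\<Gamma> \<turnstile> Hd x \<^bold>= Succ n"
  shows "\<Gamma> \<turnstile> Ap (put False a) x \<^bold>= Zero"
proof -
  have "\<Gamma> \<turnstile> Rec (Ap a (Tl x)) Zero (Succ n) \<^bold>= Zero"
    using Ax[OF ax.Rec_Succ[of "Ap a (Tl x)" Zero n]] by simp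
  from Eq_trans[OF Eq_trans[OF Ap_put_False Rec_cong[OF assms]] this] show ?thesis .
qed

lemma Ap_put_True_Zero:
  assumes "\<Gamma> \<turnstile> Hd x \<^bold>= Zero"
  shows "\<Gamma> \<turnstile> Ap (put True a) x \<^bold>= Zero"
  by (rule Eq_trans[OF Eq_trans[OF Ap_put_True Rec_cong[OF assms]] Ax[OF ax.Rec_Zero]])

text \<open>The claim covers every code \<open>x\<close>, also that of the empty sequence, whose
  \<open>Hd\<close> the axioms leave open: it suffices that \<open>Hd x\<close> is zero or a
  successor.\<close>

lemma Ap_put_zero_seq: "\<Gamma> \<turnstile> Ap (put k zero_seq) x \<^bold>= Zero"
proof (cases k)
  case True
  let ?b = "Ap zero_seq (Tl (wkN_n (wkN_n x)))" and ?H = "insert (Hd x \<^bold>= Succ (pred_tm (Hd x))) \<Gamma>"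
  have "?H \<turnstile> Rec Zero ?b (Succ (pred_tm (Hd x))) \<^bold>= Ap zero_seq (Tl x)"
    using Ax[OF ax.Rec_Succ[of Zero ?b "pred_tm (Hd x)"]] by simp
  from Eq_trans[OF Eq_trans[OF Rec_cong[OF assm_top] this] Ap_zero_seq]
  have "?H \<turnstile> Ap (put True zero_seq) x \<^bold>= Zero"
    using Eq_trans[OF Ap_put_True, of ?H zero_seq x] by simp
  with True show ?thesis
    by (simp add: nat_cases[OF Ap_put_True_Zero[OF assm_top]])
next
  case False
  have "insert (Hd x \<^bold>= Zero) \<Gamma> \<turnstile> Hd x \<^bold>= idx False"
    by (simp add: idx_def assm_top)
  from nat_cases[OF Eq_trans[OF Ap_put_at[OF this] Ap_zero_seq] Ap_put_False_Succ[OF assm_top]] False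
  show ?thesis by simp
qed

lemma Ap_put_same: "\<Gamma> \<turnstile> Ap (put k a) (Cns (idx k) x) \<^bold>= Ap a x"
  by (rule Eq_trans[OF Ap_put_at[OF Ax[OF ax.Hd_Cns]] Ap_cong[OF Ax[OF ax.Tl_Cns]]])

lemma seq_eqI: "(\<And>n. wkN ` \<Gamma> \<turnstile> Ap (wkN_s a) n \<^bold>= Ap (wkN_s b) n) \<Longrightarrow> \<Gamma> \<turnstile> seq_eq a b"
  unfolding seq_eq_def by (rule AllNI)

lemma seq_eqD: "\<Gamma> \<turnstile> seq_eq a b \<Longrightarrow> \<Gamma> \<turnstile> Ap a n \<^bold>= Ap b n"
  using AllNE[of \<Gamma> "Ap (wkN_s a) (NVar 0) \<^bold>= Ap (wkN_s b) (NVar 0)" n] by (simp add: seq_eq_def)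

lemma put_in_D2A1: "\<Gamma> \<turnstile> in_D2A1 (put k a)"
proof (cases k)
  case True
  have "\<Gamma> \<turnstile> seq_eq (sect (put True a) Zero) zero_seq"
    by (rule seq_eqI, simp, rule Eq_trans[OF Ap_sect],
        rule Eq_trans[OF Ap_put_True_Zero[OF Ax[OF ax.Hd_Cns]] Eq_sym[OF Ap_zero_seq]])
  with True show ?thesis by (simp add: in_D2A1_def OrI1)
next
  case False
  have "\<Gamma> \<turnstile> seq_eq (sect (put False a) (Succ Zero)) zero_seq"
    by (rule seq_eqI, simp, rule Eq_trans[OF Ap_sect],
        rule Eq_trans[OF Ap_put_False_Succ[OF Ax[OF ax.Hd_Cns]] Eq_sym[OF Ap_zero_seq]])
  with False show ?thesis by (simp add: in_D2A1_def OrI2)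
qed

lemma zero_seq_in_D2A1: "\<Gamma> \<turnstile> in_D2A1 zero_seq"
  unfolding in_D2A1_def
  by (rule OrI1, rule seq_eqI, simp,
      rule Eq_trans[OF Eq_trans[OF Ap_sect Ap_zero_seq] Eq_sym[OF Ap_zero_seq]])

lemma onto_D2A1_inst:
  assumes "\<Gamma> \<turnstile> onto_D2A1 g b"
  shows "\<Gamma> \<turnstile> ExS (in_spread (wkS_s b) (SVar 0) \<^bold>\<and> fun_value (wkS_s g) (SVar 0) (wkS_s c))
    \<^bold>\<longleftrightarrow> in_D2A1 c"
  using AllSE[OF assms[unfolded onto_D2A1_def], of c] by simp

lemma onto_D2A1_preimage:
  assumes "\<Gamma> \<turnstile> onto_D2A1 g b" and "\<Gamma> \<turnstile> in_D2A1 c"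
  shows "\<Gamma> \<turnstile> ExS (in_spread (wkS_s b) (SVar 0) \<^bold>\<and> fun_value (wkS_s g) (SVar 0) (wkS_s c))"
  by (rule IffD2[OF onto_D2A1_inst[OF assms(1)] assms(2)])

lemma onto_D2A1_value:
  assumes "\<Gamma> \<turnstile> onto_D2A1 g b" and "\<Gamma> \<turnstile> in_spread b a" and "\<Gamma> \<turnstile> fun_value g a c"
  shows "\<Gamma> \<turnstile> in_D2A1 c"
  by (rule IffD1[OF onto_D2A1_inst[OF assms(1)] ExSI[of _ a]]) (simp add: AndI assms(2,3))

section \<open>The universal spread, collisions, and vanishing sections\<close>

lemma spread_law_zero_seq: "\<Gamma> \<turnstile> spread_law zero_seq"
  unfolding spread_law_def
  by (rule AllNI, rule IffI, rule ExNI[of _ Zero]) (simp_all add: Ap_zero_seq)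

lemma in_spread_zero_seq: "\<Gamma> \<turnstile> in_spread zero_seq a"
  unfolding in_spread_def by (rule AllNI) (simp add: Ap_zero_seq)

text \<open>The conclusion of the theorem for arbitrary terms \<open>g\<close> and \<open>b\<close>,
  so that it can be derived in weakened contexts.\<close>

definition collision :: "stm \<Rightarrow> stm \<Rightarrow> fm"
  where "collision g b = ExS (ExS (
    in_spread (wkS_s (wkS_s b)) (SVar 1) \<^bold>\<and> in_spread (wkS_s (wkS_s b)) (SVar 0) \<^bold>\<and>
    apart (SVar 1) (SVar 0) \<^bold>\<and>
    ExS (fun_value (wkS_s (wkS_s (wkS_s g))) (SVar 2) (SVar 0) \<^bold>\<and>
      fun_value (wkS_s (wkS_s (wkS_s g))) (SVar 1) (SVar 0))))"

lemma ren_collision [simp]: "ren r q (collision g b) = collision (ren_s r q g) (ren_s r q b)"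
  by (simp add: collision_def)

lemma collisionI:
  assumes "\<Gamma> \<turnstile> in_spread b a" and "\<Gamma> \<turnstile> in_spread b a'" and "\<Gamma> \<turnstile> apart a a'"
    and "\<Gamma> \<turnstile> fun_value g a c" and "\<Gamma> \<turnstile> fun_value g a' c"
  shows "\<Gamma> \<turnstile> collision g b"
proof -
  have "\<Gamma> \<turnstile> ExS (fun_value (wkS_s g) (wkS_s a) (SVar 0) \<^bold>\<and> fun_value (wkS_s g) (wkS_s a') (SVar 0))"
    by (rule ExSI[of _ c]) (simp add: AndI assms(4,5))
  then show ?thesis
    unfolding collision_def
    by (rule_tac ExSI[of _ a], simp, rule_tac ExSI[of _ a'])
       (simp add: AndI assms(1-3))
qed

text \<open>There is no term for g|a, so its value is quantified. The last conjunct keeps the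
  information that \<open>i\<close> is 0 or 1, which would otherwise be lost when the Continuity
  Principle returns \<open>i\<close> as a mere number.\<close>

definition vanish :: "ntm \<Rightarrow> stm \<Rightarrow> stm \<Rightarrow> fm"
  where "vanish i g a = ExS (fun_value (wkS_s g) (wkS_s a) (SVar 0) \<^bold>\<and>
    seq_eq (sect (SVar 0) (wkS_n i)) zero_seq \<^bold>\<and> ((wkS_n i \<^bold>= Zero) \<^bold>\<or> (wkS_n i \<^bold>= Succ Zero)))"

lemma ren_vanish [simp]: "ren r q (vanish i g a) = vanish (ren_n r q i) (ren_s r q g) (ren_s r q a)"
  and sub_vanish [simp]: "sub \<sigma> \<tau> (vanish i g a) = vanish (sub_n \<sigma> \<tau> i) (sub_s \<sigma> \<tau> g) (sub_s \<sigma> \<tau> a)"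
  by (simp_all add: vanish_def)

text \<open>The form in which \<open>BCP\<close> on the spread delivers a constant index
  \<open>i\<close> together with the length \<open>m\<close> of the initial segment of
  \<open>a\<close> that determines it.\<close>

definition vanish_near :: "ntm \<Rightarrow> stm \<Rightarrow> stm \<Rightarrow> stm \<Rightarrow> ntm \<Rightarrow> fm"
  where "vanish_near i g b a m = AllS (in_spread (wkS_s b) (SVar 0) \<^bold>\<longrightarrow>
    (bar (SVar 0) (wkS_n m) \<^bold>= bar (wkS_s a) (wkS_n m)) \<^bold>\<longrightarrow> vanish (wkS_n i) (wkS_s g) (SVar 0))"

lemma ren_vanish_near [simp]: "ren r q (vanish_near i g b a m) =
    vanish_near (ren_n r q i) (ren_s r q g) (ren_s r q b) (ren_s r q a) (ren_n r q m)"
  and sub_vanish_near [simp]: "sub \<sigma> \<tau> (vanish_near i g b a m) =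
    vanish_near (sub_n \<sigma> \<tau> i) (sub_s \<sigma> \<tau> g) (sub_s \<sigma> \<tau> b) (sub_s \<sigma> \<tau> a) (sub_n \<sigma> \<tau> m)"
  by (simp_all add: vanish_near_def)

lemma vanish_nearD:
  assumes "\<Gamma> \<turnstile> vanish_near i g b a m" and "\<Gamma> \<turnstile> in_spread b c" and "\<Gamma> \<turnstile> bar c m \<^bold>= bar a m"
  shows "\<Gamma> \<turnstile> vanish i g c"
  using AllSE[OF assms(1)[unfolded vanish_near_def], of c]
  by (simp add: ImpE[OF ImpE[OF _ assms(2)] assms(3)])

text \<open>Values are unique, so the section \<open>idx k\<close> of g|a is both \<open>d\<close>
  and zero, although \<open>d\<close> has a nonzero entry.\<close>

lemma vanish_put_absurd:
  assumes "\<Gamma> \<turnstile> vanish (idx k) g a" and "\<Gamma> \<turnstile> fun_value g a (put k d)"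
    and "\<Gamma> \<turnstile> ExN (\<^bold>\<not> (Ap (wkN_s d) (NVar 0) \<^bold>= Zero))"
  shows "\<Gamma> \<turnstile> \<chi>"
proof -
  let ?E = "\<lambda>d. ExN (\<^bold>\<not> (Ap (wkN_s d) (NVar 0) \<^bold>= Zero))"
  let ?V = "\<lambda>g a c. fun_value g a c \<^bold>\<and> seq_eq (sect c (idx k)) zero_seq \<^bold>\<and>
    ((idx k \<^bold>= Zero) \<^bold>\<or> (idx k \<^bold>= Succ Zero))"
  have zero: "\<Delta> \<turnstile> Ap d j \<^bold>= Zero"
    if "\<Delta> \<turnstile> ?V g a c" and "\<Delta> \<turnstile> fun_value g a (put k d)" for \<Delta> g a c d j
  proof -
    have "\<Delta> \<turnstile> Ap d j \<^bold>= Ap c (Cns (idx k) j)"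
      by (rule Eq_trans[OF Eq_sym[OF Ap_put_same] fun_value_unique[OF that(2) AndE1[OF that(1)]]])
    moreover have "\<Delta> \<turnstile> Ap c (Cns (idx k) j) \<^bold>= Zero"
      by (rule Eq_trans[OF Eq_sym[OF Ap_sect]
            Eq_trans[OF seq_eqD[OF AndE1[OF AndE2[OF that(1)]]] Ap_zero_seq]])
    ultimately show ?thesis by (rule Eq_trans)
  qed
  have absurd: "\<Delta> \<turnstile> Fls" if "\<Delta> = {?V g a c, fun_value g a (put k d), ?E d}" for \<Delta> g a c d
  proof (rule ExNE)
    show "\<Delta> \<turnstile> ?E d" unfolding that by (rule Assm) simp
    let ?K = "insert (\<^bold>\<not> (Ap (wkN_s d) (NVar 0) \<^bold>= Zero)) (wkN ` \<Delta>)"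
    have "?K \<turnstile> Ap (wkN_s d) (NVar 0) \<^bold>= Zero"
      by (rule zero[of _ "wkN_s g" "wkN_s a" "wkN_s c"]) (simp_all add: Assm that)
    from NegE[OF assm_top this] show "?K \<turnstile> wkN Fls" .
  qed
  let ?H = "{vanish (idx k) g a, fun_value g a (put k d), ?E d}"
  let ?V' = "?V (wkS_s g) (wkS_s a) (SVar 0)"
  have "insert ?V' (wkS ` ?H) \<turnstile> Fls"
    by (rule weaken[OF absurd[OF refl, of "wkS_s g" "wkS_s a" "SVar 0" "wkS_s d"]]) simp
  then have "insert ?V' (wkS ` ?H) \<turnstile> wkS Fls" by simp
  moreover have "?H \<turnstile> ExS ?V'"
    by (rule Assm) (simp add: vanish_def)
  ultimately have "?H \<turnstile> Fls" by (rule ExSE[rotated])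
  then have "\<Gamma> \<turnstile> Fls" by (rule cut_set[rotated]) (use assms in auto)
  then show ?thesis by (rule FlsE)
qed

section \<open>Preimages of sequences near zero\<close>

text \<open>The relation between \<open>d\<close> and the number \<open>s\<close> to which the
  Continuity Principle on Baire space is applied. Only the code of an initial segment of the
  preimage becomes locally constant; the preimage itself may vary with \<open>d\<close>.\<close>

definition preimage_at :: "bool \<Rightarrow> stm \<Rightarrow> stm \<Rightarrow> ntm \<Rightarrow> stm \<Rightarrow> ntm \<Rightarrow> fm"
  where "preimage_at k g b m d s = ExS (in_spread (wkS_s b) (SVar 0) \<^bold>\<and>
    fun_value (wkS_s g) (SVar 0) (put k (wkS_s d)) \<^bold>\<and> (bar (SVar 0) (wkS_n m) \<^bold>= wkS_n s))"

lemma ren_preimage_at [simp]: "ren r q (preimage_at k g b m d s) =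
    preimage_at k (ren_s r q g) (ren_s r q b) (ren_n r q m) (ren_s r q d) (ren_n r q s)"
  and sub_preimage_at [simp]: "sub \<sigma> \<tau> (preimage_at k g b m d s) =
    preimage_at k (sub_s \<sigma> \<tau> g) (sub_s \<sigma> \<tau> b) (sub_n \<sigma> \<tau> m) (sub_s \<sigma> \<tau> d) (sub_n \<sigma> \<tau> s)"
  by (simp_all add: preimage_at_def)

lemma preimage_atI:
  assumes "\<Gamma> \<turnstile> in_spread b a" and "\<Gamma> \<turnstile> fun_value g a (put k d)" and "\<Gamma> \<turnstile> bar a m \<^bold>= s"
  shows "\<Gamma> \<turnstile> preimage_at k g b m d s"
  unfolding preimage_at_def by (rule ExSI[of _ a]) (simp add: AndI assms)

lemma fun_value_put_zero_seq:
  assumes "\<Gamma> \<turnstile> fun_value g a (put k zero_seq)"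
  shows "\<Gamma> \<turnstile> fun_value g a zero_seq"
proof -
  let ?N = "\<lambda>c. num_value (sect (wkN_s g) (NVar 0)) (wkN_s a) (Ap c (NVar 0))"
  have "{fun_value g a (put k zero_seq)} \<turnstile> fun_value g a zero_seq"
    unfolding fun_value_def ren_zero_seq
  proof (rule AllNI)
    let ?H = "wkN ` {AllN (num_value (sect (wkN_s g) (NVar 0)) (wkN_s a) (Ap (wkN_s (put k zero_seq)) (NVar 0)))}"
    have "?H \<turnstile> ?N (put k zero_seq)"
      using AllNE[OF Assm, of _ ?H "NVar 0"] by simp
    moreover have "?H \<turnstile> Ap (put k zero_seq) (NVar 0) \<^bold>= Ap zero_seq (NVar 0)"
      by (rule Eq_trans[OF Ap_put_zero_seq Eq_sym[OF Ap_zero_seq]])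
    ultimately show "?H \<turnstile> ?N zero_seq"
      using Eq_subst[of ?H "Ap (put k zero_seq) (NVar 0)" "Ap zero_seq (NVar 0)"
          "num_value (sect (wkN_s (wkN_s g)) (NVar 1)) (wkN_s (wkN_s a)) (NVar 0)"]
      by simp
  qed
  then show ?thesis by (rule cut_set[rotated]) (use assms in auto)
qed

text \<open>Let c and c' be preimages for \<open>zero_seq\<close> and \<open>d\<close>, both with
  initial segment \<open>s\<close>. If \<open>s\<close> were the initial segment of
  \<open>a\<close>, then c' would be close to \<open>a\<close> and the section \<open>idx k\<close>
  of its value, which is \<open>d\<close>, would vanish. Hence c is apart from \<open>a\<close>, and
  both are mapped to zero.\<close>

lemma collision_of_preimages:
  "{in_spread b a, fun_value g a zero_seq, vanish_near (idx k) g b a m,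
    preimage_at k g b m zero_seq s, preimage_at k g b m d s,
    ExN (\<^bold>\<not> (Ap (wkN_s d) (NVar 0) \<^bold>= Zero))} \<turnstile> collision g b"
proof -
  let ?E = "\<lambda>d. ExN (\<^bold>\<not> (Ap (wkN_s d) (NVar 0) \<^bold>= Zero))"
  let ?R = "\<lambda>g b m d s c. in_spread b c \<^bold>\<and> fun_value g c (put k d) \<^bold>\<and> (bar c m \<^bold>= s)"
  have core: "\<Delta> \<turnstile> collision g b" if D: "\<Delta> \<turnstile> in_spread b a" "\<Delta> \<turnstile> fun_value g a zero_seq"
      "\<Delta> \<turnstile> vanish_near (idx k) g b a m" "\<Delta> \<turnstile> ?R g b m zero_seq s c" "\<Delta> \<turnstile> ?R g b m d s c'"
      "\<Delta> \<turnstile> ?E d" for \<Delta> g b a m s d c c'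
  \<comment> \<open>The comparison is made between c and \<open>a\<close>, whereas the contradiction
    in the case of equality comes from c', which shares its initial segment with c.\<close>
  proof (rule OrE[OF bar_eq_or_apart[of _ c m a]])
    note W = D[THEN weaken_insert]
    have "insert (bar c m \<^bold>= bar a m) \<Delta> \<turnstile> bar c' m \<^bold>= bar a m"
      by (rule Eq_trans[OF AndE2[OF AndE2[OF W(5)]]
            Eq_trans[OF Eq_sym[OF AndE2[OF AndE2[OF W(4)]]] assm_top]])
    from vanish_nearD[OF W(3) AndE1[OF W(5)] this]
    show "insert (bar c m \<^bold>= bar a m) \<Delta> \<turnstile> collision g b"
      by (rule vanish_put_absurd[OF _ AndE1[OF AndE2[OF W(5)]] W(6)])
    show "insert (apart c a) \<Delta> \<turnstile> collision g b"
      by (rule collisionI[OF AndE1[OF W(4)] W(1) assm_top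
            fun_value_put_zero_seq[OF AndE1[OF AndE2[OF W(4)]]] W(2)])
  qed
  let ?w = "ren_s (\<lambda>i. i) (\<lambda>i. Suc (Suc i))" and ?v = "ren_n (\<lambda>i. i) (\<lambda>i. Suc (Suc i))"
  let ?H = "{in_spread b a, fun_value g a zero_seq, vanish_near (idx k) g b a m,
    preimage_at k g b m zero_seq s, preimage_at k g b m d s, ?E d}"
  let ?H1 = "insert (?R (wkS_s g) (wkS_s b) (wkS_n m) zero_seq (wkS_n s) (SVar 0)) (wkS ` ?H)"
  let ?H2 = "insert (?R (?w g) (?w b) (?v m) (?w d) (?v s) (SVar 0)) (wkS ` ?H1)"
  have "?H2 \<turnstile> collision (?w g) (?w b)"
    by (rule core[where a = "?w a" and m = "?v m" and s = "?v s" and c = "SVar 1" and d = "?w d"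
          and c' = "SVar 0"]) (simp_all add: Assm)
  then have "?H1 \<turnstile> collision (wkS_s g) (wkS_s b)"
    by (rule_tac ExSE[where \<phi> = "?R (?w g) (?w b) (?v m) (?w d) (?v s) (SVar 0)"])
       (simp_all add: preimage_at_def Assm)
  then show ?thesis
    by (rule_tac ExSE[where \<phi> = "?R (wkS_s g) (wkS_s b) (wkS_n m) zero_seq (wkS_n s) (SVar 0)"])
       (simp_all add: preimage_at_def Assm)
qed

definition preimages_near_zero :: "bool \<Rightarrow> stm \<Rightarrow> stm \<Rightarrow> ntm \<Rightarrow> ntm \<Rightarrow> ntm \<Rightarrow> fm"
  where "preimages_near_zero k g b m n s = AllS (in_spread zero_seq (SVar 0) \<^bold>\<longrightarrow>
    (bar (SVar 0) (wkS_n n) \<^bold>= bar zero_seq (wkS_n n)) \<^bold>\<longrightarrow>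
    preimage_at k (wkS_s g) (wkS_s b) (wkS_n m) (SVar 0) (wkS_n s))"

lemma ren_preimages_near_zero [simp]: "ren r q (preimages_near_zero k g b m n s) =
    preimages_near_zero k (ren_s r q g) (ren_s r q b) (ren_n r q m) (ren_n r q n) (ren_n r q s)"
  by (simp add: preimages_near_zero_def)

lemma preimages_near_zeroD:
  assumes "\<Gamma> \<turnstile> preimages_near_zero k g b m n s" and "\<Gamma> \<turnstile> bar d n \<^bold>= bar zero_seq n"
  shows "\<Gamma> \<turnstile> preimage_at k g b m d s"
  using AllSE[OF assms(1)[unfolded preimages_near_zero_def], of d]
  by (simp add: ImpE[OF ImpE[OF _ in_spread_zero_seq] assms(2)])

text \<open>The zero sequence and a nonzero \<open>d\<close> from \<open>near_zero_seq\<close> both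
  agree with zero up to \<open>n\<close>, and so have preimages with the same initial segment
  \<open>s\<close>.\<close>

lemma collision_of_preimages_near_zero:
  "{in_spread b a, fun_value g a zero_seq, vanish_near (idx k) g b a m,
    preimages_near_zero k g b m n s} \<turnstile> collision g b" (is "?H \<turnstile> _")
proof (rule ExSE[OF near_zero_seq[of _ n]])
  let ?K = "insert ((bar (SVar 0) (wkS_n n) \<^bold>= bar zero_seq (wkS_n n)) \<^bold>\<and>
    ExN (\<^bold>\<not> (Ap (SVar 0) (NVar 0) \<^bold>= Zero))) (wkS ` ?H)"
  have near: "?K \<turnstile> preimages_near_zero k (wkS_s g) (wkS_s b) (wkS_n m) (wkS_n n) (wkS_n s)"
    by (simp add: Assm)
  have 1: "?K \<turnstile> preimage_at k (wkS_s g) (wkS_s b) (wkS_n m) zero_seq (wkS_n s)"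
    by (rule preimages_near_zeroD[OF near Eq_refl])
  have 2: "?K \<turnstile> preimage_at k (wkS_s g) (wkS_s b) (wkS_n m) (SVar 0) (wkS_n s)"
    by (rule preimages_near_zeroD[OF near AndE1[OF assm_top]])
  have 3: "?K \<turnstile> ExN (\<^bold>\<not> (Ap (wkN_s (SVar 0)) (NVar 0) \<^bold>= Zero))"
    using AndE2[OF assm_top] by simp
  have 4: "?K \<turnstile> in_spread (wkS_s b) (wkS_s a)" "?K \<turnstile> fun_value (wkS_s g) (wkS_s a) zero_seq"
    "?K \<turnstile> vanish_near (idx k) (wkS_s g) (wkS_s b) (wkS_s a) (wkS_n m)"
    by (simp_all add: Assm)
  have "?K \<turnstile> collision (wkS_s g) (wkS_s b)"
    by (rule cut_set[OF _ collision_of_preimages[of "wkS_s b" "wkS_s a" "wkS_s g" k "wkS_n m"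
            "wkS_n s" "SVar 0"]])
       (use 1 2 3 4 in \<open>auto simp del: ren_s.simps image_insert\<close>)
  then show "?K \<turnstile> wkS (collision g b)" by simp
qed

text \<open>Every \<open>put k d\<close> lies in D^2(A_1) and has a preimage in the spread.
  Assigning to \<open>d\<close> the initial segment of length \<open>m\<close> of such a preimage is
  a relation between sequences and numbers, and \<open>BCP\<close> is applied to it at the zero
  sequence.\<close>

lemma preimages_continuous:
  assumes "\<Gamma> \<turnstile> onto_D2A1 g b"
  shows "\<Gamma> \<turnstile> ExN (ExN (preimages_near_zero k (wkN_s (wkN_s g)) (wkN_s (wkN_s b))
    (wkN_n (wkN_n m)) (NVar 1) (NVar 0)))"
proof -
  let ?\<phi> = "\<lambda>g b m d. preimage_at k (wkN_s g) (wkN_s b) (wkN_n m) (wkN_s d) (NVar 0)"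
  let ?G = "{onto_D2A1 g b}"
  have step: "\<Delta> \<turnstile> ExN (?\<phi> g b m d)" if "\<Delta> \<turnstile> in_spread b a" "\<Delta> \<turnstile> fun_value g a (put k d)"
    for \<Delta> g b m d a
    by (rule ExNI[of _ "bar a m"]) (use preimage_atI[OF that Eq_refl] in simp)
  let ?H = "insert (in_spread zero_seq (SVar 0)) (wkS ` ?G)"
  have "?H \<turnstile> onto_D2A1 (wkS_s g) (wkS_s b)"
    by (simp add: Assm)
  note ex = onto_D2A1_preimage[OF this put_in_D2A1[of _ k "SVar 0"]]
  have "?H \<turnstile> ExN (?\<phi> (wkS_s g) (wkS_s b) (wkS_n m) (SVar 0))"
  proof (rule ExSE[OF ex])
    let ?R = "in_spread (wkS_s (wkS_s b)) (SVar 0) \<^bold>\<and>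
      fun_value (wkS_s (wkS_s g)) (SVar 0) (wkS_s (put k (SVar 0)))"
    have "insert ?R (wkS ` ?H) \<turnstile> fun_value (wkS_s (wkS_s g)) (SVar 0) (put k (SVar 1))"
      using AndE2[OF assm_top[of ?R "wkS ` ?H"]] by simp
    from step[OF AndE1[OF assm_top] this, of "wkS_n (wkS_n m)"]
    show "insert ?R (wkS ` ?H) \<turnstile> wkS (ExN (?\<phi> (wkS_s g) (wkS_s b) (wkS_n m) (SVar 0)))"
      by simp
  qed
  from AllSI[OF ImpI[OF this]]
  have "?G \<turnstile> AllS (in_spread (wkS_s zero_seq) (SVar 0) \<^bold>\<longrightarrow>
      ExN (?\<phi> (wkS_s g) (wkS_s b) (wkS_n m) (SVar 0)))"
    by simp
  from AllSE[OF ImpE[OF ImpE[OF Ax[OF ax.BCP] spread_law_zero_seq] this], of zero_seq]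
  have "?G \<turnstile> in_spread zero_seq zero_seq \<^bold>\<longrightarrow> ExN (ExN (preimages_near_zero k (wkN_s (wkN_s g))
      (wkN_s (wkN_s b)) (wkN_n (wkN_n m)) (NVar 1) (NVar 0)))"
    by (simp add: preimages_near_zero_def)
  from ImpE[OF this in_spread_zero_seq] show ?thesis
    by (rule cut_set[rotated]) (use assms in auto)
qed

lemma collision_of_vanish_near:
  assumes "\<Gamma> \<turnstile> onto_D2A1 g b" and "\<Gamma> \<turnstile> in_spread b a" and "\<Gamma> \<turnstile> fun_value g a zero_seq"
    and "\<Gamma> \<turnstile> vanish_near (idx k) g b a m"
  shows "\<Gamma> \<turnstile> collision g b"
proof -
  let ?w = "ren_s (\<lambda>i. Suc (Suc i)) (\<lambda>i. i)" and ?v = "ren_n (\<lambda>i. Suc (Suc i)) (\<lambda>i. i)"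
  let ?G = "{onto_D2A1 g b, in_spread b a, fun_value g a zero_seq, vanish_near (idx k) g b a m}"
  let ?U = "preimages_near_zero k (?w g) (?w b) (?v m) (NVar 1) (NVar 0)"
  have "?G \<turnstile> onto_D2A1 g b" by (simp add: Assm)
  from preimages_continuous[OF this, of k m] have ex: "?G \<turnstile> ExN (ExN ?U)" by simp
  have "insert ?U (wkN ` insert (ExN ?U) (wkN ` ?G)) \<turnstile> collision (?w g) (?w b)"
    by (rule weaken[OF collision_of_preimages_near_zero[of "?w b" "?w a" "?w g" k "?v m" "NVar 1" "NVar 0"]])
       simp
  then have "insert ?U (wkN ` insert (ExN ?U) (wkN ` ?G)) \<turnstile> wkN (wkN (collision g b))"
    by simp
  from ExNE[OF ex ExNE[OF assm_top this]] show ?thesis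
    by (rule cut_set[rotated]) (use assms in auto)
qed

section \<open>The Continuity Principle on the spread and the conclusion\<close>

text \<open>Each element of the spread has a value, which lies in D^2(A_1); the disjunct that holds
  there provides an index 0 or 1. \<open>BCP\<close> makes this index constant near
  \<open>a\<close>.\<close>

lemma vanish_near_exists:
  assumes "\<Gamma> \<turnstile> spread_law b" and "\<Gamma> \<turnstile> codes_fun g b" and "\<Gamma> \<turnstile> onto_D2A1 g b"
    and "\<Gamma> \<turnstile> in_spread b a"
  shows "\<Gamma> \<turnstile> ExN (ExN (vanish_near (NVar 0) (wkN_s (wkN_s g)) (wkN_s (wkN_s b))
    (wkN_s (wkN_s a)) (NVar 1)))"
proof -
  let ?G = "{spread_law b, codes_fun g b, onto_D2A1 g b, in_spread b a}"
  let ?H = "insert (in_spread (wkS_s b) (SVar 0)) (wkS ` ?G)"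
  let ?\<phi> = "vanish (NVar 0) (wkN_s (wkS_s g)) (SVar 0)"
  have step: "\<Delta> \<turnstile> ExN (vanish (NVar 0) (wkN_s g) (wkN_s a))"
    if "\<Delta> \<turnstile> fun_value g a c" "\<Delta> \<turnstile> in_D2A1 c" for \<Delta> g a c
  proof -
    \<comment> \<open>One argument for both disjuncts, used with \<open>k\<close> false for section
      0 and \<open>k\<close> true for section 1.\<close>
    have v: "\<Theta> \<turnstile> ExN (vanish (NVar 0) (wkN_s g) (wkN_s a))"
      if "\<Theta> \<turnstile> fun_value g a c" "\<Theta> \<turnstile> seq_eq (sect c (idx k)) zero_seq" for \<Theta> k
    proof -
      have "\<Theta> \<turnstile> (idx k \<^bold>= Zero) \<^bold>\<or> (idx k \<^bold>= Succ Zero)"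
        by (cases k) (simp_all add: idx_def OrI1 OrI2 Eq_refl)
      with that have "\<Theta> \<turnstile> vanish (idx k) g a"
        unfolding vanish_def by (rule_tac ExSI[of _ c]) (simp add: AndI)
      then show ?thesis by (rule_tac ExNI[of _ "idx k"]) simp
    qed
    show ?thesis
      by (rule OrE[OF that(2)[unfolded in_D2A1_def] v[of _ False] v[of _ True]])
         (simp_all add: idx_def assm_top weaken_insert[OF that(1)])
  qed
  have H: "?H \<turnstile> codes_fun (wkS_s g) (wkS_s b)" by (simp add: Assm)
  note ex = fun_value_exists[OF H assm_top]
  have "?H \<turnstile> ExN ?\<phi>"
  proof (rule ExSE[OF ex])
    let ?F = "fun_value (wkS_s (wkS_s g)) (wkS_s (SVar 0)) (SVar 0)"
    let ?K = "insert ?F (wkS ` ?H)"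
    have K: "?K \<turnstile> onto_D2A1 (wkS_s (wkS_s g)) (wkS_s (wkS_s b))"
        "?K \<turnstile> in_spread (wkS_s (wkS_s b)) (wkS_s (SVar 0))"
      by (simp_all add: Assm)
    from step[OF assm_top onto_D2A1_value[OF K assm_top]]
    show "?K \<turnstile> wkS (ExN ?\<phi>)" by simp
  qed
  from AllSI[OF ImpI[OF this]]
  have "?G \<turnstile> AllS (in_spread (wkS_s b) (SVar 0) \<^bold>\<longrightarrow> ExN ?\<phi>)" .
  moreover have "?G \<turnstile> spread_law b" by (simp add: Assm)
  ultimately have "?G \<turnstile> in_spread b a \<^bold>\<longrightarrow> ExN (ExN (vanish_near (NVar 0) (wkN_s (wkN_s g))
      (wkN_s (wkN_s b)) (wkN_s (wkN_s a)) (NVar 1)))"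
    using AllSE[OF ImpE[OF ImpE[OF Ax[OF ax.BCP]]], of ?G b ?\<phi> a]
    by (simp add: vanish_near_def)
  moreover have "?G \<turnstile> in_spread b a" by (simp add: Assm)
  ultimately have "?G \<turnstile> ExN (ExN (vanish_near (NVar 0) (wkN_s (wkN_s g))
      (wkN_s (wkN_s b)) (wkN_s (wkN_s a)) (NVar 1)))" by (rule ImpE)
  then show ?thesis
    by (rule cut_set[rotated]) (use assms in auto)
qed

lemma vanish_index:
  assumes "\<Gamma> \<turnstile> vanish i g a"
  shows "\<Gamma> \<turnstile> (i \<^bold>= Zero) \<^bold>\<or> (i \<^bold>= Succ Zero)"
  by (rule ExSE[OF assms[unfolded vanish_def]]) (use AndE2[OF AndE2[OF assm_top]] in simp)

lemma collision_of_onto: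
  assumes "\<Gamma> \<turnstile> spread_law b" and "\<Gamma> \<turnstile> codes_fun g b" and "\<Gamma> \<turnstile> onto_D2A1 g b"
    and "\<Gamma> \<turnstile> in_spread b a" and "\<Gamma> \<turnstile> fun_value g a zero_seq"
  shows "\<Gamma> \<turnstile> collision g b"
proof -
  let ?w = "ren_s (\<lambda>i. Suc (Suc i)) (\<lambda>i. i)"
  let ?G = "{onto_D2A1 g b, in_spread b a, fun_value g a zero_seq, spread_law b, codes_fun g b}"
  let ?U = "vanish_near (NVar 0) (?w g) (?w b) (?w a) (NVar 1)"
  have G: "?G \<turnstile> spread_law b" "?G \<turnstile> codes_fun g b" "?G \<turnstile> onto_D2A1 g b" "?G \<turnstile> in_spread b a"
    by (simp_all add: Assm)
  have ex: "?G \<turnstile> ExN (ExN ?U)" using vanish_near_exists[OF G] by simp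
  let ?K = "insert ?U (wkN ` insert (ExN ?U) (wkN ` ?G))"
  have K: "?K \<turnstile> onto_D2A1 (?w g) (?w b)" "?K \<turnstile> in_spread (?w b) (?w a)"
      "?K \<turnstile> fun_value (?w g) (?w a) zero_seq"
    by (simp_all add: Assm)
  \<comment> \<open>The index returned by \<open>BCP\<close> is the variable \<open>NVar 0\<close>.
    Under the assumption that it equals \<open>idx k\<close>, the Leibniz scheme replaces it by that
    term, as the lemmas with a fixed \<open>k\<close> require.\<close>
  have case_idx: "insert (NVar 0 \<^bold>= idx k) ?K \<turnstile> collision (?w g) (?w b)" for k
  proof (rule collision_of_vanish_near[OF K[THEN weaken_insert], where k = k and m = "NVar 1"])
    have "insert (NVar 0 \<^bold>= idx k) ?K \<turnstile> ?U" by (simp add: Assm)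
    then show "insert (NVar 0 \<^bold>= idx k) ?K \<turnstile> vanish_near (idx k) (?w g) (?w b) (?w a) (NVar 1)"
      using Eq_subst[OF assm_top[of "NVar 0 \<^bold>= idx k" ?K],
          of "vanish_near (NVar 0) (wkN_s (?w g)) (wkN_s (?w b)) (wkN_s (?w a)) (NVar 2)"] by simp
  qed
  have "?K \<turnstile> collision (?w g) (?w b)"
    \<comment> \<open>Since \<open>a\<close> agrees with itself, \<open>vanish\<close> holds at
      \<open>a\<close>, and its last conjunct says that the index is 0 or 1.\<close>
    by (rule OrE[OF vanish_index[OF vanish_nearD[OF assm_top K(2) Eq_refl]]])
       (use case_idx[of False] case_idx[of True] in \<open>simp_all add: idx_def\<close>)
  then have "?K \<turnstile> wkN (wkN (collision g b))" by simp
  from ExNE[OF ex ExNE[OF assm_top this]] show ?thesis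
    by (rule cut_set[rotated]) (use assms in auto)
qed

(* De Bruijn indices: under the two outer quantifiers the law of the spread F is SVar 1 and gamma is
   SVar 0; under the two inner ones gamma is SVar 2, the law of F is SVar 3, alpha is SVar 1 and
   beta is SVar 0 (and one more each, with the common value SVar 0, under the last ExS). *)

theorem theorem6p5:
  shows "{} \<turnstile> AllS (AllS (
    spread_law (SVar 1) \<^bold>\<and> codes_fun (SVar 0) (SVar 1) \<^bold>\<and> onto_D2A1 (SVar 0) (SVar 1) \<^bold>\<longrightarrow>
    ExS (ExS (
      in_spread (SVar 3) (SVar 1) \<^bold>\<and> in_spread (SVar 3) (SVar 0) \<^bold>\<and>
      apart (SVar 1) (SVar 0) \<^bold>\<and>
      ExS (fun_value (SVar 3) (SVar 2) (SVar 0) \<^bold>\<and> fun_value (SVar 3) (SVar 1) (SVar 0))))))"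
proof -
  let ?A = "spread_law (SVar 1) \<^bold>\<and> codes_fun (SVar 0) (SVar 1) \<^bold>\<and> onto_D2A1 (SVar 0) (SVar 1)"
  have A: "{?A} \<turnstile> onto_D2A1 (SVar 0) (SVar 1)"
    by (rule AndE2[OF AndE2[OF assm_top]])
  \<comment> \<open>The first point of the collision is a preimage of the zero sequence, which
    belongs to D^2(A_1).\<close>
  let ?R = "in_spread (SVar 2) (SVar 0) \<^bold>\<and> fun_value (SVar 1) (SVar 0) zero_seq"
  have ex: "{?A} \<turnstile> ExS ?R"
    using onto_D2A1_preimage[OF A zero_seq_in_D2A1] by simp
  let ?K = "insert ?R (wkS ` {?A})"
  have W: "?K \<turnstile> spread_law (SVar 2) \<^bold>\<and> codes_fun (SVar 1) (SVar 2) \<^bold>\<and> onto_D2A1 (SVar 1) (SVar 2)"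
    by (simp add: Assm)
  have "?K \<turnstile> collision (SVar 1) (SVar 2)"
    by (rule collision_of_onto[OF AndE1[OF W] AndE1[OF AndE2[OF W]] AndE2[OF AndE2[OF W]]
          AndE1[OF assm_top] AndE2[OF assm_top]])
  then have "?K \<turnstile> wkS (collision (SVar 0) (SVar 1))" by simp
  from ImpI[OF ExSE[OF ex this]] have "{} \<turnstile> AllS (AllS (?A \<^bold>\<longrightarrow> collision (SVar 0) (SVar 1)))"
    by (intro AllSI) simp
  then show ?thesis by (simp add: collision_def)
qed

end
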